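(* Let $s,k$ be two positive integers and $\mu$ a partition of $n$. Then $$(p_s\diamond q_k(t))\,H_\mu.1=\sum_{\lambda\vdash n+sk,\ \mu\subset\lambda}\ \sum_{\nu\models k}\frac{b_\mu(t)}{b_\lambda(t)}(1-t^s)^{l(\nu)}B(\mu,\lambda-s\nu)\,H_\lambda.1,$$ where $\nu=(\nu_1,\dots,\nu_{l(\lambda)})$ runs over compositions of $k$ into $l(\lambda)$ nonnegative parts.
   Context: $l(\cdot)$ is the number of positive parts of a partition or composition; a composition $\nu\models k$ is a list of nonnegative integers with sum $k$; $\mu\subset\lambda$ means $\mu_i\le\lambda_i$ for all $i$; $\lambda-s\nu=(\lambda_1-s\nu_1,\lambda_2-s\nu_2,\dots)$. Let $\Lambda_{\mathbb Q(t)}=\mathbb Q(t)[p_1,p_2,\dots]$ be the ring of symmetric functions over $\mathbb Q(t)$ ($p_m$ power sums). Operators $H_m$ ($m\in\mathbb Z$) on $\Lambda_{\mathbb Q(t)}$ are defined by $$H(z)=\exp\Big(\sum_{m\ge1}\tfrac{1-t^m}{m}p_mz^m\Big)\exp\Big(-\sum_{m\ge1}\tfrac{\partial}{\partial p_m}z^{-m}\Big)=\sum_{m\in\mathbb Z}H_mz^m,$$ and $H_\lambda.1=H_{\lambda_1}\cdots H_{\lambda_l}.1$, which for a partition $\lambda$ is the Hall–Littlewood function $Q_\lambda(t)$. The $q_m(t)$ are given by $\sum_{m\ge0}q_m(t)z^m=\exp(\sum_{m\ge1}\frac{1-t^m}{m}p_mz^m)$. The $t$-plethysm: for $g=\sum_\lambda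 c_\lambda(t)p_\lambda$, $g\diamond f=\sum_\lambda c_\lambda(t)\prod_if(x_1^{\lambda_i},x_2^{\lambda_i},\dots;t^{\lambda_i})$; in particular $p_s\diamond q_k(t)=q_k(x_1^s,x_2^s,\dots;t^s)$ (replace $p_m$ by $p_{sm}$ and $t$ by $t^s$). Also $b_\lambda(t)=(1-t)^{l(\lambda)}\prod_{i\ge1}[m_i(\lambda)]!$ with $m_i(\lambda)$ the multiplicity of $i$ in $\lambda$, $[n]=\frac{1-t^n}{1-t}$, $[n]!=[n][n-1]\cdots[1]$. Coefficients $B$: let $\alpha=(\alpha_1,\dots,\alpha_l)$ be a finite sequence of integers with $\alpha_i<\alpha_{i+1}$ for some $i$. For $0\le a\le\lfloor(\alpha_{i+1}-\alpha_i)/2\rfloor$ let $S_{i,a}\alpha$ be obtained from $\alpha$ by replacing the entries $(\alpha_i,\alpha_{i+1})$ in positions $i,i+1$ by $(\alpha_{i+1}-a,\alpha_i+a)$, with weight $C(S_{i,a})=t$ if $a=0$; $C(S_{i,a})=t^{a+1}-t^{a-1}$ if $1\le a<\lfloor\frac{\alpha_{i+1}-\alpha_i}2\rfloor$; and $C(S_{i,a})=t^{a+\epsilon}-t^{a-1}$ if $a=\lfloor\frac{\alpha_{i+1}-\alpha_i}2\rfloor\ge1$, where $\epsilon\in\{0,1\}$, $\epsilon\equiv\alpha_{i+1}-\alpha_i\pmod 2$. A canonical straightening path from $\alpha$ to a partition $\rho$ is a sequence $\alpha=\alpha^{(0)},\alpha^{(1)},\dots,\alpha^{(r)}=\rho$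 ($r\ge0$) in which each $\alpha^{(j)}$ with $j<r$ is not weakly decreasing, and $\alpha^{(j)}=S_{i_j,a_j}\alpha^{(j-1)}$ with $i_j$ the minimal index such that $\alpha^{(j-1)}_{i_j}<\alpha^{(j-1)}_{i_j+1}$. Then $B(\rho,\alpha)$ is the sum over all canonical straightening paths from $\alpha$ to $\rho$ of $\prod_{j=1}^rC(S_{i_j,a_j})$ (empty product $=1$, empty sum $=0$). Here a partition $\rho$ is identified with the sequences obtained by appending zeros. *)

theory Defs
  imports
    "HOL-Library.Poly_Mapping"
    "HOL-Computational_Algebra.Computational_Algebra"
begin

section \<open>The ring \<open>\<Lambda>\<close> of symmetric functions over \<open>\<rat>(t)\<close>\<close>

text \<open>
  \<open>\<Lambda> = \<rat>(t)[p\<^sub>1, p\<^sub>2, \<dots>]\<close> is the ring of polynomials in countably many variables,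
  i.e. finitely supported functions from exponent vectors to \<open>\<rat>(t)\<close>.
  The index of an exponent vector is shifted by one: position \<open>i\<close> holds the exponent of
  \<open>p\<^bsub>i+1\<^esub>\<close>, so that there is no spurious variable \<open>p\<^sub>0\<close>.
\<close>

type_synonym ratfun = "rat poly fract"
type_synonym symfun = "(nat \<Rightarrow>\<^sub>0 nat) \<Rightarrow>\<^sub>0 ratfun"

definition tvar :: ratfun where
  "tvar = Fraction_Field.Fract [:0, 1:] 1"

definition scal :: "ratfun \<Rightarrow> symfun" where
  "scal c = Poly_Mapping.single 0 c"

text \<open>The power sum \<open>p\<^sub>m\<close>; only meaningful for \<open>m \<ge> 1\<close>.\<close>

definition psum :: "nat \<Rightarrow> symfun" where
  "psum m = Poly_Mapping.single (Poly_Mapping.single (m - 1) 1) 1"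

text \<open>The partial derivative \<open>\<partial>/\<partial>p\<^sub>m\<close>, for \<open>m \<ge> 1\<close>.\<close>

definition pderiv_psum :: "nat \<Rightarrow> symfun \<Rightarrow> symfun" where
  "pderiv_psum m f = (\<Sum>e\<in>Poly_Mapping.keys f.
     Poly_Mapping.single (e - Poly_Mapping.single (m - 1) 1)
       (of_nat (Poly_Mapping.lookup e (m - 1)) * Poly_Mapping.lookup f e))"

section \<open>The functions \<open>q\<^sub>m(t)\<close> and the operators \<open>H\<^sub>m\<close>\<close>

definition exp_fps :: "symfun fps" where
  "exp_fps = Abs_fps (\<lambda>n. scal (1 / fact n))"

definition qfun :: "nat \<Rightarrow> symfun" where
  "qfun m = fps_nth (fps_compose exp_fps
     (Abs_fps (\<lambda>m. if m = 0 then 0 else scal ((1 - tvar ^ m) / of_nat m) * psum m))) m"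

text \<open>
  The operator \<open>- (\<Sum>m\<ge>1. \<partial>/\<partial>p\<^sub>m w\<^sup>m)\<close> on \<open>\<Lambda>[[w]]\<close>, where \<open>w = z\<^sup>-\<^sup>1\<close>, and the
  coefficient of \<open>w\<^sup>j\<close> in its exponential applied to \<open>f \<in> \<Lambda>\<close>. The operator raises the order
  in \<open>w\<close> by at least one, so its \<open>r\<close>-th powers with \<open>r > j\<close> do not contribute to that coefficient.
\<close>

definition lower_op :: "symfun fps \<Rightarrow> symfun fps" where
  "lower_op F = Abs_fps (\<lambda>j. - (\<Sum>m=1..j. pderiv_psum m (fps_nth F (j - m))))"

definition lower_coeff :: "nat \<Rightarrow> symfun \<Rightarrow> symfun" where
  "lower_coeff j f = (\<Sum>r\<le>j. scal (1 / fact r) * fps_nth ((lower_op ^^ r) (fps_const f)) j)"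

text \<open>
  The coefficient of \<open>z\<^sup>m\<close> in \<open>H(z) f\<close>. The sum over \<open>j\<close> has finite support, see
  \<open>finite_support_H_op\<close> below.
\<close>

definition H_op :: "int \<Rightarrow> symfun \<Rightarrow> symfun" where
  "H_op m f = Sum_any (\<lambda>j::nat.
     (if m + int j < 0 then 0 else qfun (nat (m + int j))) * lower_coeff j f)"

definition H_seq :: "int list \<Rightarrow> symfun" where
  "H_seq \<alpha> = foldr H_op \<alpha> 1"

section \<open>The \<open>t\<close>-plethysm\<close>

lemma pcompose_monom_eq_0_iff:
  fixes a :: "rat poly"
  assumes "r \<ge> 1"
  shows "pcompose a (monom 1 r) = 0 \<longleftrightarrow> a = 0"
  using assms by (intro pcompose_eq_0_iff) (simp add: degree_monom_eq)

text \<open>The substitution \<open>t \<mapsto> t\<^sup>r\<close> in \<open>\<rat>(t)\<close>, only meaningful for \<open>r \<ge> 1\<close>.\<close>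

definition subst_t :: "nat \<Rightarrow> ratfun \<Rightarrow> ratfun" where
  "subst_t r x = (THE y. \<exists>a b. b \<noteq> 0 \<and> x = Fraction_Field.Fract a b \<and>
     y = Fraction_Field.Fract (pcompose a (monom 1 r)) (pcompose b (monom 1 r)))"

lemma subst_t_Fract:
  assumes "r \<ge> 1" and "b \<noteq> 0"
  shows "subst_t r (Fraction_Field.Fract a b) =
     Fraction_Field.Fract (pcompose a (monom 1 r)) (pcompose b (monom 1 r))"
  unfolding subst_t_def
proof (rule the_equality)
  show "\<exists>c d. d \<noteq> 0 \<and> Fraction_Field.Fract a b = Fraction_Field.Fract c d \<and>
     Fraction_Field.Fract (pcompose a (monom 1 r)) (pcompose b (monom 1 r)) =
     Fraction_Field.Fract (pcompose c (monom 1 r)) (pcompose d (monom 1 r))"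
    using assms by blast
next
  fix y
  assume "\<exists>c d. d \<noteq> 0 \<and> Fraction_Field.Fract a b = Fraction_Field.Fract c d \<and>
     y = Fraction_Field.Fract (pcompose c (monom 1 r)) (pcompose d (monom 1 r))"
  then show "y = Fraction_Field.Fract (pcompose a (monom 1 r)) (pcompose b (monom 1 r))"
    using assms by (auto simp: eq_fract pcompose_monom_eq_0_iff simp flip: pcompose_mult)
qed

text \<open>\<open>f(x\<^sub>1\<^sup>r, x\<^sub>2\<^sup>r, \<dots>; t\<^sup>r)\<close>: replace every \<open>p\<^sub>m\<close> by \<open>p\<^bsub>rm\<^esub>\<close> and \<open>t\<close> by \<open>t\<^sup>r\<close>.\<close>

definition power_subst :: "nat \<Rightarrow> symfun \<Rightarrow> symfun" where
  "power_subst r f = (\<Sum>e\<in>Poly_Mapping.keys f. scal (subst_t r (Poly_Mapping.lookup f e)) *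
     (\<Prod>i\<in>Poly_Mapping.keys e. psum (r * Suc i) ^ Poly_Mapping.lookup e i))"

text \<open>An exponent vector \<open>e\<close> encodes the partition in which the part \<open>i + 1\<close> has multiplicity \<open>e i\<close>.\<close>

definition plethysm :: "symfun \<Rightarrow> symfun \<Rightarrow> symfun"  (infixr "\<diamondop>" 75) where
  "g \<diamondop> f = (\<Sum>e\<in>Poly_Mapping.keys g. scal (Poly_Mapping.lookup g e) *
     (\<Prod>i\<in>Poly_Mapping.keys e. power_subst (Suc i) f ^ Poly_Mapping.lookup e i))"

section \<open>Partitions and compositions\<close>

text \<open>Partitions are lists of positive parts, without trailing zeros.\<close>

definition partitions_of :: "nat \<Rightarrow> nat list set" where
  "partitions_of n = {lam. sorted_wrt (\<ge>) lam \<and> (\<forall>x\<in>set lam. 0 < x) \<and> sum_list lam = n}"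

definition compositions_of :: "nat \<Rightarrow> nat \<Rightarrow> nat list set" where
  "compositions_of k l = {\<nu>. length \<nu> = l \<and> sum_list \<nu> = k}"

definition num_parts :: "nat list \<Rightarrow> nat" where
  "num_parts \<nu> = length (filter (\<lambda>x. 0 < x) \<nu>)"

definition part :: "nat list \<Rightarrow> nat \<Rightarrow> nat" where
  "part lam i = (if i < length lam then lam ! i else 0)"

definition part_contained :: "nat list \<Rightarrow> nat list \<Rightarrow> bool" where
  "part_contained \<mu> lam \<longleftrightarrow> (\<forall>i. part \<mu> i \<le> part lam i)"

definition sub_scaled :: "nat list \<Rightarrow> nat \<Rightarrow> nat list \<Rightarrow> int list" where
  "sub_scaled lam s \<nu> = map2 (\<lambda>x y. int x - int s * int y) lam \<nu>"

definition qint :: "nat \<Rightarrow> ratfun" where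
  "qint n = (1 - tvar ^ n) / (1 - tvar)"

definition qfact :: "nat \<Rightarrow> ratfun" where
  "qfact n = (\<Prod>j=1..n. qint j)"

definition b_coeff :: "nat list \<Rightarrow> ratfun" where
  "b_coeff lam = (1 - tvar) ^ num_parts lam * (\<Prod>i\<in>set lam - {0}. qfact (count_list lam i))"

section \<open>Canonical straightening paths and the coefficients \<open>B\<close>\<close>

definition first_ascent :: "int list \<Rightarrow> nat \<Rightarrow> bool" where
  "first_ascent \<alpha> i \<longleftrightarrow>
     Suc i < length \<alpha> \<and> \<alpha> ! i < \<alpha> ! Suc i \<and> (\<forall>j<i. \<alpha> ! Suc j \<le> \<alpha> ! j)"

definition S_step :: "nat \<Rightarrow> nat \<Rightarrow> int list \<Rightarrow> int list" where
  "S_step i a \<alpha> = \<alpha>[i := \<alpha> ! Suc i - int a, Suc i := \<alpha> ! i + int a]"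

definition max_shift :: "nat \<Rightarrow> int list \<Rightarrow> nat" where
  "max_shift i \<alpha> = nat ((\<alpha> ! Suc i - \<alpha> ! i) div 2)"

definition S_weight :: "nat \<Rightarrow> nat \<Rightarrow> int list \<Rightarrow> ratfun" where
  "S_weight i a \<alpha> =
     (if a = 0 then tvar
      else if a < max_shift i \<alpha> then tvar ^ (a + 1) - tvar ^ (a - 1)
      else tvar ^ (a + nat ((\<alpha> ! Suc i - \<alpha> ! i) mod 2)) - tvar ^ (a - 1))"

text \<open>
  A path from \<open>\<alpha>\<close> is recorded by the list of its steps \<open>(i\<^sub>j, a\<^sub>j)\<close>, which determines the
  intermediate sequences and is determined by them. Positions are counted from \<open>0\<close>. The final
  sequence has to be the partition \<open>\<rho>\<close> up to trailing zeros.
\<close>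

fun canonical_path :: "nat list \<Rightarrow> int list \<Rightarrow> (nat \<times> nat) list \<Rightarrow> bool" where
  "canonical_path \<rho> \<alpha> [] \<longleftrightarrow> (\<exists>d. \<alpha> = map int \<rho> @ replicate d 0)"
| "canonical_path \<rho> \<alpha> ((i, a) # ps) \<longleftrightarrow>
     first_ascent \<alpha> i \<and> a \<le> max_shift i \<alpha> \<and> canonical_path \<rho> (S_step i a \<alpha>) ps"

fun path_weight :: "int list \<Rightarrow> (nat \<times> nat) list \<Rightarrow> ratfun" where
  "path_weight \<alpha> [] = 1"
| "path_weight \<alpha> ((i, a) # ps) = S_weight i a \<alpha> * path_weight (S_step i a \<alpha>) ps"

text \<open>The index set is finite, see \<open>finite_canonical_paths\<close> below.\<close>

definition B_coeff :: "nat list \<Rightarrow> int list \<Rightarrow> ratfun" where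
  "B_coeff \<rho> \<alpha> = (\<Sum>ps\<in>{ps. canonical_path \<rho> \<alpha> ps}. path_weight \<alpha> ps)"

section \<open>Finiteness of the sums involved\<close>

lemma finite_lists_bounded: "finite {xs. set xs \<subseteq> {..n::nat} \<and> length xs \<le> l}"
  by (rule finite_lists_length_le) simp

lemma finite_partitions_of: "finite (partitions_of n)"
proof (rule finite_subset[OF _ finite_lists_bounded[of n n]])
  have "length xs \<le> sum_list xs" if "\<forall>x\<in>set xs. 0 < x" for xs :: "nat list"
    using that by (induction xs) auto
  then show "partitions_of n \<subseteq> {xs. set xs \<subseteq> {..n} \<and> length xs \<le> n}"
    by (auto simp: partitions_of_def member_le_sum_list)
qed

lemma finite_compositions_of: "finite (compositions_of k l)"
  by (rule finite_subset[OF _ finite_lists_bounded[of k l]])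
     (auto simp: compositions_of_def member_le_sum_list)

definition wt :: "(nat \<Rightarrow>\<^sub>0 nat) \<Rightarrow> nat" where
  "wt e = (\<Sum>i\<in>Poly_Mapping.keys e. Suc i * Poly_Mapping.lookup e i)"

lemma wt_superset:
  "finite A \<Longrightarrow> Poly_Mapping.keys e \<subseteq> A \<Longrightarrow> wt e = (\<Sum>i\<in>A. Suc i * Poly_Mapping.lookup e i)"
  unfolding wt_def by (rule sum.mono_neutral_left) (auto simp: in_keys_iff)

lemma wt_minus_single:
  assumes "Poly_Mapping.lookup e i > 0"
  shows "wt (e - Poly_Mapping.single i 1) + Suc i = wt e"
proof -
  let ?e = "e - Poly_Mapping.single i 1"
  have e: "e = ?e + Poly_Mapping.single i 1"
    using assms by (intro poly_mapping_eqI) (auto simp: lookup_add lookup_minus lookup_single when_def)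
  let ?A = "insert i (Poly_Mapping.keys e \<union> Poly_Mapping.keys ?e)"
  have "wt e = (\<Sum>j\<in>?A. Suc j * Poly_Mapping.lookup e j)"
    by (rule wt_superset) auto
  also have "\<dots> = (\<Sum>j\<in>?A. Suc j * Poly_Mapping.lookup (?e + Poly_Mapping.single i 1) j)"
    by (simp only: e[symmetric])
  also have "\<dots> = (\<Sum>j\<in>?A. Suc j * Poly_Mapping.lookup ?e j)
      + (\<Sum>j\<in>?A. Suc j * Poly_Mapping.lookup (Poly_Mapping.single i (1::nat)) j)"
    unfolding lookup_add by (simp only: distrib_left sum.distrib)
  also have "(\<Sum>j\<in>?A. Suc j * Poly_Mapping.lookup ?e j) = wt ?e"
    by (rule wt_superset[symmetric]) auto
  also have "(\<Sum>j\<in>?A. Suc j * Poly_Mapping.lookup (Poly_Mapping.single i (1::nat)) j)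
      = (\<Sum>j\<in>?A. if j = i then Suc i else 0)"
    by (intro sum.cong) (auto simp: lookup_single when_def)
  also have "\<dots> = Suc i"
    by (subst sum.delta) auto
  finally show ?thesis by simp
qed

lemma keys_sum_E:
  assumes "e \<in> Poly_Mapping.keys (sum g A)"
  obtains x where "x \<in> A" "e \<in> Poly_Mapping.keys (g x)"
  using subsetD[OF keys_sum assms] by (rule UN_E)

lemma wt_pderiv_psum:
  assumes "\<And>e. e \<in> Poly_Mapping.keys f \<Longrightarrow> wt e + c \<le> N"
    and "m \<ge> 1" and "e \<in> Poly_Mapping.keys (pderiv_psum m f)"
  shows "wt e + (c + m) \<le> N"
proof -
  from assms(3) obtain e' where e': "e' \<in> Poly_Mapping.keys f" and
    "e \<in> Poly_Mapping.keys (Poly_Mapping.single (e' - Poly_Mapping.single (m - 1) 1)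
       (of_nat (Poly_Mapping.lookup e' (m - 1)) * Poly_Mapping.lookup f e'))"
    unfolding pderiv_psum_def by (elim keys_sum_E)
  then have "e = e' - Poly_Mapping.single (m - 1) 1" "Poly_Mapping.lookup e' (m - 1) > 0"
    by (auto split: if_splits)
  then show ?thesis
    using wt_minus_single[of e' "m - 1"] assms(1)[OF e'] \<open>m \<ge> 1\<close> by simp
qed

lemma lower_op_nth:
  "fps_nth (lower_op F) j = - (\<Sum>m=1..j. pderiv_psum m (fps_nth F (j - m)))"
  by (simp add: lower_op_def)

lemma wt_lower_op_power:
  assumes "\<And>e. e \<in> Poly_Mapping.keys f \<Longrightarrow> wt e \<le> N"
    and "e \<in> Poly_Mapping.keys (fps_nth ((lower_op ^^ r) (fps_const f)) j)"
  shows "wt e + j \<le> N"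
  using assms(2)
proof (induction r arbitrary: e j)
  case 0
  then show ?case using assms(1) by (cases j) auto
next
  case (Suc r)
  let ?F = "(lower_op ^^ r) (fps_const f)"
  have "e \<in> Poly_Mapping.keys (\<Sum>m=1..j. pderiv_psum m (fps_nth ?F (j - m)))"
    using Suc.prems by (simp add: lower_op_nth)
  then obtain m where m: "m \<in> {1..j}" "e \<in> Poly_Mapping.keys (pderiv_psum m (fps_nth ?F (j - m)))"
    by (elim keys_sum_E)
  have "wt e + (j - m + m) \<le> N"
    by (rule wt_pderiv_psum[OF Suc.IH _ m(2)]) (use m in auto)
  then show ?case using m by simp
qed

lemma finite_support_H_op:
  "finite {j. (if m + int j < 0 then 0 else qfun (nat (m + int j))) * lower_coeff j f \<noteq> 0}"
proof -
  define N where "N = Max (insert 0 (wt ` Poly_Mapping.keys f))"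
  have N: "wt e \<le> N" if "e \<in> Poly_Mapping.keys f" for e
    unfolding N_def using that by (intro Max_ge) auto
  have "lower_coeff j f = 0" if "j > N" for j
  proof -
    have "fps_nth ((lower_op ^^ r) (fps_const f)) j = 0" for r
    proof -
      have "Poly_Mapping.keys (fps_nth ((lower_op ^^ r) (fps_const f)) j) = {}"
        using wt_lower_op_power[OF N] that by fastforce
      then show ?thesis by simp
    qed
    then show ?thesis by (simp add: lower_coeff_def)
  qed
  then have zero: "(if m + int j < 0 then 0 else qfun (nat (m + int j))) * lower_coeff j f = 0"
    if "j > N" for j
    using that by simp
  show ?thesis
    by (rule finite_subset[of _ "{..N}"]) (use zero not_le in blast, simp)
qed

lemma finite_canonical_paths_aux:
  assumes "\<forall>x\<in>set \<alpha>. c \<le> x"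
    and "nat (\<Sum>i<length \<alpha>. int i * (\<alpha> ! i - c)) < N"
  shows "finite {ps. canonical_path \<rho> \<alpha> ps}"
  using assms
proof (induction N arbitrary: \<alpha>)
  case 0
  then show ?case by simp
next
  case (Suc N)
  let ?I = "{(i, a). first_ascent \<alpha> i \<and> a \<le> max_shift i \<alpha>}"
  have "?I \<subseteq> Sigma {..<length \<alpha>} (\<lambda>i. {..max_shift i \<alpha>})"
    by (auto simp: first_ascent_def)
  then have fin: "finite ?I"
    by (rule finite_subset) auto
  have step: "finite {ps. canonical_path \<rho> (S_step i a \<alpha>) ps}" if "(i, a) \<in> ?I" for i a
  proof (rule Suc.IH)
    let ?\<beta> = "S_step i a \<alpha>"
    from that have i: "Suc i < length \<alpha>" "\<alpha> ! i < \<alpha> ! Suc i"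
      and "a \<le> max_shift i \<alpha>"
      by (auto simp: first_ascent_def)
    then have a: "2 * int a \<le> \<alpha> ! Suc i - \<alpha> ! i"
      by (simp add: max_shift_def)
    have len: "length ?\<beta> = length \<alpha>" by (simp add: S_step_def)
    have nth: "?\<beta> ! j = (if j = i then \<alpha> ! Suc i - int a else
        if j = Suc i then \<alpha> ! i + int a else \<alpha> ! j)" if "j < length \<alpha>" for j
      using that by (auto simp: S_step_def nth_list_update)
    have ge: "c \<le> \<alpha> ! j" if "j < length \<alpha>" for j using Suc.prems(1) that by auto
    have ge': "c \<le> ?\<beta> ! j" if "j < length \<alpha>" for j
      using ge[of i] ge[of "Suc i"] ge[OF that] i a that by (auto simp: nth)
    then show "\<forall>x\<in>set ?\<beta>. c \<le> x" by (auto simp: in_set_conv_nth len)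
    have split: "(\<Sum>j<length \<alpha>. h j) = h i + h (Suc i) + (\<Sum>j\<in>{..<length \<alpha>} - {i, Suc i}. h j)"
      for h :: "nat \<Rightarrow> int"
    proof -
      have "(\<Sum>j<length \<alpha>. h j) = (\<Sum>j\<in>{..<length \<alpha>} - {i, Suc i}. h j) + (\<Sum>j\<in>{i, Suc i}. h j)"
        using i by (intro sum.subset_diff) auto
      then show ?thesis by simp
    qed
    have "(\<Sum>j<length \<alpha>. int j * (?\<beta> ! j - c)) < (\<Sum>j<length \<alpha>. int j * (\<alpha> ! j - c))"
    proof -
      have "(\<Sum>j\<in>{..<length \<alpha>} - {i, Suc i}. int j * (?\<beta> ! j - c)) =
          (\<Sum>j\<in>{..<length \<alpha>} - {i, Suc i}. int j * (\<alpha> ! j - c))"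
        by (intro sum.cong) (auto simp: nth)
      moreover have "int i * (?\<beta> ! i - c) + int (Suc i) * (?\<beta> ! Suc i - c) <
          int i * (\<alpha> ! i - c) + int (Suc i) * (\<alpha> ! Suc i - c)"
        using i a by (simp add: nth algebra_simps)
      ultimately show ?thesis
        unfolding split[of "\<lambda>j. int j * (?\<beta> ! j - c)"] split[of "\<lambda>j. int j * (\<alpha> ! j - c)"] by linarith
    qed
    moreover have "0 \<le> (\<Sum>j<length \<alpha>. int j * (?\<beta> ! j - c))"
      using ge' by (intro sum_nonneg) auto
    ultimately show "nat (\<Sum>j<length ?\<beta>. int j * (?\<beta> ! j - c)) < N"
      using Suc.prems(2) unfolding len by linarith
  qed
  have "{ps. canonical_path \<rho> \<alpha> ps} \<subseteq>
      insert [] (\<Union>x\<in>?I. (#) x ` {ps. canonical_path \<rho> (S_step (fst x) (snd x) \<alpha>) ps})"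
  proof
    fix ps assume "ps \<in> {ps. canonical_path \<rho> \<alpha> ps}"
    then show "ps \<in> insert [] (\<Union>x\<in>?I. (#) x ` {ps. canonical_path \<rho> (S_step (fst x) (snd x) \<alpha>) ps})"
      by (cases "(\<rho>, \<alpha>, ps)" rule: canonical_path.cases) auto
  qed
  moreover have "finite (insert [] (\<Union>x\<in>?I. (#) x ` {ps. canonical_path \<rho> (S_step (fst x) (snd x) \<alpha>) ps}))"
    using fin step by auto
  ultimately show ?case by (rule finite_subset)
qed

lemma finite_canonical_paths: "finite {ps. canonical_path \<rho> \<alpha> ps}"
proof (rule finite_canonical_paths_aux[OF _ lessI])
  show "\<forall>x\<in>set \<alpha>. Min (insert 0 (set \<alpha>)) \<le> x" by simp
qed

end

theory Submission
  imports Defs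
begin

text \<open>
  The coefficient of \<open>H\<^sub>\<lambda>.1\<close> is found by pairing with \<open>H\<^sub>\<lambda>.1\<close>. For the Hall-Littlewood scalar
  product the functions \<open>H\<^sub>\<lambda>.1\<close>, \<open>\<lambda>\<close> a partition, form an orthogonal basis of \<open>\<Lambda>\<close>, and
  \<open>H\<^sub>\<lambda>.1\<close> has norm \<open>b\<^sub>\<lambda>\<close>. The adjoint of multiplication by \<open>p\<^sub>s \<diamondop> q\<^sub>k\<close> maps \<open>H\<^sub>\<lambda>.1\<close> to the sum of
  \<open>(1 - t\<^sup>s)\<^bsup>l(\<nu>)\<^esup> H\<^bsub>\<lambda>-s\<nu>\<^esub>.1\<close> over the compositions \<open>\<nu>\<close> of \<open>k\<close>, since the generating series of the
  \<open>p\<^sub>s \<diamondop> q\<^sub>k\<close> commutes with the vertex operators up to the factor \<open>(1 - t\<^sup>s x) / (1 - x)\<close>, whose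
  coefficients are \<open>1\<close> and then always \<open>1 - t\<^sup>s\<close>. The quadratic relation between the vertex operators
  rewrites \<open>H\<^bsub>\<lambda>-s\<nu>\<^esub>.1\<close> along the canonical straightening paths, so that its pairing with
  \<open>H\<^sub>\<mu>.1\<close> is \<open>B(\<mu>, \<lambda> - s\<nu>) b\<^sub>\<mu>\<close>. Division by the norm \<open>b\<^sub>\<lambda>\<close> gives the coefficient.

  Instead of the scalar product, only the functionals \<open>f \<mapsto> \<langle>f, H\<^sub>\<alpha>.1\<rangle>\<close> are constructed
  (\<open>pairing\<close>): if \<open>K\<^sub>m\<close> is the adjoint of \<open>H\<^sub>m\<close>, then such a functional is the constant term of
  \<open>K\<^bsub>\<alpha>\<^sub>l\<^esub> \<cdots> K\<^bsub>\<alpha>\<^sub>1\<^esub> f\<close>. The operator \<open>K\<^sub>m\<close> is the conjugate of \<open>H\<^bsub>-m\<^esub>\<close> by the automorphism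
  \<open>p\<^sub>d \<mapsto> - p\<^sub>d\<close>. No calculus of formal series in several variables is needed, because the operators
  are determined by their values at \<open>1\<close> and their commutators with the power sums,
  \<open>H\<^sub>m p\<^sub>d = p\<^sub>d H\<^sub>m - H\<^bsub>m+d\<^esub>\<close> and \<open>K\<^sub>m p\<^sub>d = p\<^sub>d K\<^sub>m + K\<^bsub>m-d\<^esub>\<close>. An identity between
  operators that is compatible with these commutators follows from its instance at \<open>1\<close>, by
  induction over the ring (\<open>symfun_induct\<close>).

  The facts that carry the proof are: the quadratic relations \<open>K_op_exchange\<close> and \<open>H_op_exchange\<close>;
  the relation \<open>K_op_H_op_reorder\<close> between the two families, which yields the orthogonality
  \<open>pairing_H_seq_partitions\<close>; the commutation \<open>pairing_plethysm_times\<close> with the plethysm; the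
  straightening \<open>pairing_H_seq\<close>; and the spanning property \<open>HL_span_UNIV\<close>, which makes a symmetric
  function determined by its pairings (\<open>pairing_nondegenerate\<close>).
\<close>

section \<open>Induction over the ring of symmetric functions\<close>

lemma scal_0 [simp]: "scal 0 = 0"
  and scal_1 [simp]: "scal 1 = 1"
  by (simp_all add: scal_def)

lemma scal_add: "scal (a + b) = scal a + scal b"
  and scal_diff: "scal (a - b) = scal a - scal b"
  and scal_uminus: "scal (- a) = - scal a"
  by (simp_all add: scal_def single_add single_diff single_uminus)

lemma scal_mult: "scal (a * b) = scal a * scal b"
  by (simp add: scal_def mult_single)

lemma scal_of_nat [simp]: "scal (of_nat n) = of_nat n"
  by (simp add: scal_def)

lemma scal_sum: "scal (\<Sum>x\<in>A. f x) = (\<Sum>x\<in>A. scal (f x))"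
  by (induction A rule: infinite_finite_induct) (simp_all add: scal_add)

lemma scal_times_single: "scal c * Poly_Mapping.single e d = Poly_Mapping.single e (c * d)"
  by (simp add: scal_def mult_single)

lemma psum_times_single:
  "psum d * Poly_Mapping.single e c = Poly_Mapping.single (e + Poly_Mapping.single (d - 1) 1) c"
  by (simp add: psum_def mult_single add.commute)

lemma symfun_single_induct [case_names add single]:
  assumes add: "\<And>f g. P f \<Longrightarrow> P g \<Longrightarrow> P (f + g)"
    and single: "\<And>e c. P (Poly_Mapping.single e c)"
  shows "P (f :: symfun)"
proof (induction f rule: update_induct)
  case const
  show ?case using single[of 0 0] by simp
next
  case (update f a b)
  have "Poly_Mapping.update a b f = Poly_Mapping.single a b + f"
    using update by (intro poly_mapping_eqI)
      (auto simp: lookup_update lookup_add lookup_single when_def in_keys_iff)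
  then show ?case using add[OF single update.IH] by simp
qed

text \<open>
  The identities between operators below are linear and compatible with multiplication by power
  sums, so that this rule reduces them to the function \<open>1\<close>.
\<close>

lemma symfun_induct [case_names one scal add psum]:
  assumes one: "P 1"
    and scal: "\<And>c f. P f \<Longrightarrow> P (scal c * f)"
    and add: "\<And>f g. P f \<Longrightarrow> P g \<Longrightarrow> P (f + g)"
    and psum: "\<And>d f. d \<ge> 1 \<Longrightarrow> P f \<Longrightarrow> P (psum d * f)"
  shows "P f"
proof (induction f rule: symfun_single_induct)
  case (single e c)
  have mon: "P (Poly_Mapping.single (e + Poly_Mapping.single a b) 1)"
    if "P (Poly_Mapping.single e 1)" for e :: "nat \<Rightarrow>\<^sub>0 nat" and a b :: nat
  proof (induction b)
    case (Suc b)
    have "Poly_Mapping.single a (Suc b) = Poly_Mapping.single a b + Poly_Mapping.single a 1"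
      by (simp flip: single_add)
    then have "Poly_Mapping.single (e + Poly_Mapping.single a (Suc b)) 1 =
       psum (Suc a) * Poly_Mapping.single (e + Poly_Mapping.single a b) 1"
      by (simp add: psum_times_single add.assoc)
    then show ?case using psum[OF _ Suc.IH, of "Suc a"] by simp
  qed (use that in simp)
  have "P (Poly_Mapping.single e 1)"
  proof (induction e rule: update_induct)
    case const
    show ?case using one by simp
  next
    case (update e a b)
    have "Poly_Mapping.update a b e = e + Poly_Mapping.single a b"
      using update by (intro poly_mapping_eqI)
        (auto simp: lookup_update lookup_add lookup_single when_def in_keys_iff)
    then show ?case using mon[OF update.IH] by simp
  qed
  from scal[OF this, of c] show ?case by (simp add: scal_times_single)
qed (rule add)

definition lin :: "(symfun \<Rightarrow> symfun) \<Rightarrow> bool" where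
  "lin T \<longleftrightarrow> (\<forall>f g. T (f + g) = T f + T g) \<and> (\<forall>c f. T (scal c * f) = scal c * T f)"

lemma lin_add: "lin T \<Longrightarrow> T (f + g) = T f + T g"
  and lin_scal: "lin T \<Longrightarrow> T (scal c * f) = scal c * T f"
  by (simp_all add: lin_def)

lemma lin_0: "lin T \<Longrightarrow> T 0 = 0"
  using lin_scal[of T 0 0] by simp

lemma lin_uminus: "lin T \<Longrightarrow> T (- f) = - T f"
  using lin_scal[of T "- 1" f] by (simp add: scal_uminus)

lemma lin_diff: "lin T \<Longrightarrow> T (f - g) = T f - T g"
  using lin_add[of T f "- g"] by (simp add: lin_uminus)

lemma lin_sum: "lin T \<Longrightarrow> T (\<Sum>x\<in>A. f x) = (\<Sum>x\<in>A. T (f x))"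
  by (induction A rule: infinite_finite_induct) (simp_all add: lin_0 lin_add)

lemma lin_id: "lin (\<lambda>f. f)"
  by (simp add: lin_def)

lemma lin_comp: "lin S \<Longrightarrow> lin T \<Longrightarrow> lin (\<lambda>f. S (T f))"
  by (simp add: lin_def)

lemma sum_keys_superset:
  fixes g :: "'a \<Rightarrow> 'b::zero \<Rightarrow> 'c::comm_monoid_add"
  assumes "\<And>e. g e 0 = 0" "finite A" "Poly_Mapping.keys f \<subseteq> A"
  shows "(\<Sum>e\<in>Poly_Mapping.keys f. g e (Poly_Mapping.lookup f e)) =
    (\<Sum>e\<in>A. g e (Poly_Mapping.lookup f e))"
  using assms by (intro sum.mono_neutral_left) (auto simp: in_keys_iff)

text \<open>
  The derivatives, the sign change \<open>p\<^sub>d \<mapsto> - p\<^sub>d\<close> and the substitution \<open>p\<^sub>d \<mapsto> p\<^bsub>sd\<^esub>\<close> are all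
  defined by sums over the support of this shape.
\<close>

lemma sum_keys_add:
  fixes g :: "'a \<Rightarrow> 'b::comm_monoid_add \<Rightarrow> 'c::comm_monoid_add"
  assumes "\<And>e. g e 0 = 0" "\<And>e a b. g e (a + b) = g e a + g e b"
  shows "(\<Sum>e\<in>Poly_Mapping.keys (f + f'). g e (Poly_Mapping.lookup (f + f') e)) =
    (\<Sum>e\<in>Poly_Mapping.keys f. g e (Poly_Mapping.lookup f e)) +
    (\<Sum>e\<in>Poly_Mapping.keys f'. g e (Poly_Mapping.lookup f' e))"
proof -
  let ?A = "Poly_Mapping.keys f \<union> Poly_Mapping.keys f'"
  have "(\<Sum>e\<in>Poly_Mapping.keys h. g e (Poly_Mapping.lookup h e)) =
      (\<Sum>e\<in>?A. g e (Poly_Mapping.lookup h e))" if "Poly_Mapping.keys h \<subseteq> ?A" for h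
    using that by (intro sum_keys_superset assms(1)) auto
  from this[of f] this[of f'] this[of "f + f'"] show ?thesis
    using keys_add[of f f'] by (simp add: lookup_add assms(2) sum.distrib)
qed

section \<open>Commutation of \<open>H\<^sub>m\<close> with power sums\<close>

lemma pderiv_psum_add: "pderiv_psum m (f + g) = pderiv_psum m f + pderiv_psum m g"
  unfolding pderiv_psum_def by (rule sum_keys_add) (simp_all add: distrib_left single_add)

lemma pderiv_psum_single:
  "pderiv_psum m (Poly_Mapping.single e c) =
    Poly_Mapping.single (e - Poly_Mapping.single (m - 1) 1)
      (of_nat (Poly_Mapping.lookup e (m - 1)) * c)"
  by (simp add: pderiv_psum_def)

lemma pderiv_psum_scal: "pderiv_psum m (scal c * f) = scal c * pderiv_psum m f"
  by (induction f rule: symfun_single_induct)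
    (simp_all add: distrib_left pderiv_psum_add pderiv_psum_single scal_times_single mult.left_commute)

lemma lin_pderiv_psum: "lin (pderiv_psum m)"
  by (simp add: lin_def pderiv_psum_add pderiv_psum_scal)

lemma pderiv_psum_one: "pderiv_psum m 1 = 0"
  using pderiv_psum_single[of m 0 1] by simp

lemma pderiv_psum_psum_times:
  assumes "m \<ge> 1" "d \<ge> 1"
  shows "pderiv_psum m (psum d * f) = psum d * pderiv_psum m f + (if d = m then f else 0)"
proof (induction f rule: symfun_single_induct)
  case (add f g)
  then show ?case by (auto simp: distrib_left pderiv_psum_add)
next
  case (single e c)
  let ?s = "\<lambda>d. Poly_Mapping.single (d - 1) (1::nat)"
  show ?case
  proof (cases "d = m")
    case True
    have "?s m + (e - ?s m) = e" if "Poly_Mapping.lookup e (m - 1) > 0"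
      using that by (intro poly_mapping_eqI) (auto simp: lookup_add lookup_minus lookup_single when_def)
    then show ?thesis
      using True by (cases "Poly_Mapping.lookup e (m - 1) = 0")
        (auto simp: psum_times_single pderiv_psum_single lookup_add add.commute distrib_left
          distrib_right single_add)
  next
    case False
    then have "Poly_Mapping.lookup (e + ?s d) (m - 1) = Poly_Mapping.lookup e (m - 1)"
      and "Poly_Mapping.lookup e (m - 1) > 0 \<Longrightarrow> e + ?s d - ?s m = e - ?s m + ?s d"
      using assms by (auto simp: lookup_add lookup_minus lookup_single when_def poly_mapping_eq_iff fun_eq_iff)
    then show ?thesis
      using False by (cases "Poly_Mapping.lookup e (m - 1) = 0")
        (auto simp: psum_times_single pderiv_psum_single)
  qed
qed

lemma lower_op_add: "lower_op (F + G) = lower_op F + lower_op G"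
  by (intro fps_ext) (simp add: lower_op_nth pderiv_psum_add sum.distrib)

lemma lower_op_scal: "lower_op (fps_const (scal c) * F) = fps_const (scal c) * lower_op F"
  by (intro fps_ext) (simp add: lower_op_nth pderiv_psum_scal sum_distrib_left)

lemma lower_op_zero: "lower_op 0 = 0"
  using lower_op_add[of 0 0] by simp

lemma lower_op_diff: "lower_op (F - G) = lower_op F - lower_op G"
  using lower_op_add[of "F - G" G] by simp

lemma lower_op_of_nat: "lower_op (of_nat n * F) = of_nat n * lower_op F"
  using lower_op_scal[of "of_nat n" F] by (simp add: fps_of_nat)

lemma lower_op_X: "lower_op (fps_X ^ d * F) = fps_X ^ d * lower_op F"
proof (rule fps_ext)
  fix j
  have "(\<Sum>m=1..j. pderiv_psum m (fps_nth (fps_X ^ d * F) (j - m))) =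
      (\<Sum>m=1..j - d. pderiv_psum m (fps_nth F (j - d - m)))"
    by (rule sum.mono_neutral_cong_right) (auto simp: fps_X_power_mult_nth lin_0[OF lin_pderiv_psum], simp add: add.commute)
  then show "fps_nth (lower_op (fps_X ^ d * F)) j = fps_nth (fps_X ^ d * lower_op F) j"
    by (simp add: lower_op_nth fps_X_power_mult_nth)
qed

lemma lower_op_psum:
  assumes "d \<ge> 1"
  shows "lower_op (fps_const (psum d) * F) = fps_const (psum d) * lower_op F - fps_X ^ d * F"
proof (rule fps_ext)
  fix j
  have "(\<Sum>m=1..j. pderiv_psum m (fps_nth (fps_const (psum d) * F) (j - m))) =
      (\<Sum>m=1..j. psum d * pderiv_psum m (fps_nth F (j - m)) + (if d = m then fps_nth F (j - m) else 0))"
    using assms by (intro sum.cong) (auto simp: pderiv_psum_psum_times)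
  also have "\<dots> = psum d * (\<Sum>m=1..j. pderiv_psum m (fps_nth F (j - m))) + (if d \<le> j then fps_nth F (j - d) else 0)"
    using assms by (simp add: sum.distrib sum_distrib_left)
  finally show "fps_nth (lower_op (fps_const (psum d) * F)) j =
      fps_nth (fps_const (psum d) * lower_op F - fps_X ^ d * F) j"
    by (simp add: lower_op_nth fps_X_power_mult_nth)
qed

text \<open>
  By the Leibniz rule the commutator of \<open>A = lower_op\<close> with \<open>p\<^sub>d\<close> is \<open>- w\<^sup>d\<close>, which in turn commutes
  with \<open>A\<close>; hence the commutator of \<open>A\<^sup>r\<close> with \<open>p\<^sub>d\<close> is \<open>- r w\<^sup>d A\<^bsup>r-1\<^esup>\<close>.
\<close>

lemma lower_op_power_psum:
  assumes "d \<ge> 1"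
  shows "(lower_op ^^ r) (fps_const (psum d) * F) =
    fps_const (psum d) * (lower_op ^^ r) F - of_nat r * (fps_X ^ d * (lower_op ^^ (r - 1)) F)"
proof (induction r)
  case (Suc r)
  have *: "lower_op (of_nat r * (fps_X ^ d * (lower_op ^^ (r - 1)) F)) =
      of_nat r * (fps_X ^ d * (lower_op ^^ r) F)"
    by (cases r) (simp_all add: lower_op_of_nat lower_op_X lower_op_zero del: of_nat_Suc)
  show ?case
    unfolding funpow.simps o_apply Suc.IH lower_op_diff lower_op_psum[OF assms] *
    by (simp add: algebra_simps)
qed simp

lemma lower_op_power_order:
  "j < r \<Longrightarrow> fps_nth ((lower_op ^^ r) F) j = 0"
proof (induction r arbitrary: j)
  case (Suc r)
  then show ?case
    by (auto simp: lower_op_nth lin_0[OF lin_pderiv_psum] intro!: sum.neutral)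
qed simp

lemma lower_op_power_add: "(lower_op ^^ r) (F + G) = (lower_op ^^ r) F + (lower_op ^^ r) G"
  by (induction r) (simp_all add: lower_op_add)

lemma lower_op_power_scal:
  "(lower_op ^^ r) (fps_const (scal c) * F) = fps_const (scal c) * (lower_op ^^ r) F"
  by (induction r) (simp_all add: lower_op_scal)

lemma lin_lower_coeff: "lin (lower_coeff j)"
  unfolding lin_def
proof safe
  show "lower_coeff j (f + g) = lower_coeff j f + lower_coeff j g" for f g
    by (simp add: lower_coeff_def lower_op_power_add sum.distrib distrib_left flip: fps_const_add)
  show "lower_coeff j (scal c * f) = scal c * lower_coeff j f" for c f
    by (simp add: lower_coeff_def lower_op_power_scal sum_distrib_left mult.left_commute flip: fps_const_mult)
qed

lemma lower_coeff_one: "lower_coeff j 1 = (if j = 0 then 1 else 0)"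
proof -
  have "(lower_op ^^ r) (fps_const 1) = 0" if "r > 0" for r
    using that
  proof (induction r)
    case (Suc r)
    have 0: "lower_op (fps_const 1) = 0" "lower_op 0 = 0"
      by (auto simp: fps_eq_iff lower_op_nth pderiv_psum_one lin_0[OF lin_pderiv_psum] intro!: sum.neutral)
    then show ?case using Suc by (cases r) auto
  qed simp
  then have "fps_nth ((lower_op ^^ r) (fps_const 1)) j = (if r = 0 \<and> j = 0 then 1 else 0)" for r
    by (cases "r = 0") auto
  then have "lower_coeff j 1 = (\<Sum>r\<le>j. if r = 0 then (if j = 0 then 1 else 0) else 0)"
    unfolding lower_coeff_def by (intro sum.cong) auto
  then show ?thesis by simp
qed

text \<open>
  Summing the commutators of \<open>A\<^sup>r / r!\<close> with \<open>p\<^sub>d\<close> gives \<open>exp(A) p\<^sub>d = (p\<^sub>d - w\<^sup>d) exp(A)\<close>; this is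
  the coefficient of \<open>w\<^sup>j\<close>.
\<close>

lemma lower_coeff_psum:
  assumes "d \<ge> 1"
  shows "lower_coeff j (psum d * f) = psum d * lower_coeff j f - (if d \<le> j then lower_coeff (j - d) f else 0)"
proof -
  define A where "A r i = fps_nth ((lower_op ^^ r) (fps_const f)) i" for r i
  have L: "lower_coeff i f = (\<Sum>r\<le>i. scal (1 / fact r) * A r i)" for i
    by (simp add: lower_coeff_def A_def)
  have pow: "fps_nth ((lower_op ^^ r) (fps_const (psum d * f))) j =
      psum d * A r j - of_nat r * (if d \<le> j then A (r - 1) (j - d) else 0)" for r
  proof -
    have "fps_nth (of_nat r * (fps_X ^ d * (lower_op ^^ (r - 1)) (fps_const f))) j =
      of_nat r * (if d \<le> j then A (r - 1) (j - d) else 0)"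
      by (simp add: fps_X_power_mult_nth A_def flip: fps_of_nat)
    then show ?thesis
      using lower_op_power_psum[OF assms, of r "fps_const f"] by (simp add: A_def)
  qed
  have "(\<Sum>r\<le>j. scal (1 / fact r) * (of_nat r * (if d \<le> j then A (r - 1) (j - d) else 0))) =
      (if d \<le> j then lower_coeff (j - d) f else 0)"
  proof (cases "d \<le> j")
    case True
    then obtain j' where j': "j = Suc j'" using assms by (cases j) auto
    \<comment> \<open>The factor \<open>r\<close> of the commutator turns \<open>1 / r!\<close> into \<open>1 / (r - 1)!\<close>.\<close>
    have cancel: "scal (1 / fact (Suc r)) * (of_nat (Suc r) * x) = scal (1 / fact r) * x" for r x
    proof -
      have "(of_nat (Suc r) :: ratfun) \<noteq> 0"
        by (simp del: of_nat_Suc)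
      then have "(1 / fact (Suc r)) * of_nat (Suc r) = (1 / fact r :: ratfun)"
        by (simp del: of_nat_Suc)
      then have "scal (1 / fact (Suc r)) * of_nat (Suc r) = scal (1 / fact r)"
        by (simp only: flip: scal_of_nat scal_mult)
      then show ?thesis
        by (simp only: flip: mult.assoc)
    qed
    have "(\<Sum>r\<le>j. scal (1 / fact r) * (of_nat r * (if d \<le> j then A (r - 1) (j - d) else 0))) =
        (\<Sum>r\<le>j'. scal (1 / fact r) * A r (j - d))"
      using True unfolding j' sum.atMost_Suc_shift by (simp add: cancel del: of_nat_Suc fact_Suc)
    also have "\<dots> = (\<Sum>r\<le>j - d. scal (1 / fact r) * A r (j - d))"
      using assms j' by (intro sum.mono_neutral_right) (auto simp: A_def lower_op_power_order)
    finally show ?thesis using True by (simp add: L)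
  qed simp
  then show ?thesis
    unfolding lower_coeff_def[of j "psum d * f"] pow L[of j]
    by (simp add: right_diff_distrib sum_subtractf sum_distrib_left mult.left_commute)
qed

text \<open>
  The recursion \<open>u Y'(u) = (\<Sum>d\<ge>1. x\<^sub>d u\<^sup>d) Y(u)\<close> with \<open>Y(0) = 1\<close>, that is
  \<open>Y(u) = exp (\<Sum>d\<ge>1. x\<^sub>d u\<^sup>d / d)\<close>. It is Newton's identity when \<open>x\<^sub>d = p\<^sub>d\<close>. In this form only
  products with the \<open>x\<^sub>d\<close> occur, which is what the operators are known to respect.
\<close>

definition newton :: "(nat \<Rightarrow> 'a::comm_ring_1) \<Rightarrow> (nat \<Rightarrow> 'a) \<Rightarrow> bool" where
  "newton x y \<longleftrightarrow> y 0 = 1 \<and> (\<forall>n. of_nat n * y n = (\<Sum>d=1..n. x d * y (n - d)))"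

lemma newton_0: "newton x y \<Longrightarrow> y 0 = 1"
  and newton_rec: "newton x y \<Longrightarrow> of_nat n * y n = (\<Sum>d=1..n. x d * y (n - d))"
  by (simp_all add: newton_def)

text \<open>
  The derivative of the exponential that defines the \<open>q\<^sub>m\<close>, coefficient by coefficient.
\<close>

lemma newton_qfun: "newton (\<lambda>d. scal (1 - tvar ^ d) * psum d) qfun"
proof -
  define x where "x d = scal (1 - tvar ^ d) * psum d" for d
  define G where "G = Abs_fps (\<lambda>m. if m = 0 then 0 else scal ((1 - tvar ^ m) / of_nat m) * psum m)"
  define Q where "Q = fps_compose exp_fps G"
  have q: "qfun n = fps_nth Q n" for n
    by (simp add: qfun_def Q_def G_def)
  have G0: "fps_nth G 0 = 0"
    by (simp add: G_def)
  have "fps_nth (fps_deriv exp_fps) n = fps_nth exp_fps n" for n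
  proof -
    have "(of_nat (Suc n) :: ratfun) \<noteq> 0"
      by (simp del: of_nat_Suc)
    then have "of_nat (Suc n) * (1 / fact (Suc n)) = (1 / fact n :: ratfun)"
      by (simp del: of_nat_Suc)
    then have "of_nat (Suc n) * scal (1 / fact (Suc n)) = scal (1 / fact n)"
      by (simp only: flip: scal_of_nat scal_mult)
    then show ?thesis
      by (simp add: exp_fps_def del: of_nat_Suc fact_Suc)
  qed
  then have "fps_deriv exp_fps = exp_fps"
    by (intro fps_ext)
  then have deriv: "fps_deriv Q = Q * fps_deriv G"
    unfolding Q_def by (simp add: fps_compose_deriv[OF G0])
  have dG: "fps_nth (fps_deriv G) n = x (Suc n)" for n
  proof -
    have "(of_nat (Suc n) :: ratfun) \<noteq> 0"
      by (simp del: of_nat_Suc)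
    then have "of_nat (Suc n) * ((1 - tvar ^ Suc n) / of_nat (Suc n)) = 1 - tvar ^ Suc n"
      by (simp del: of_nat_Suc)
    then have "of_nat (Suc n) * scal ((1 - tvar ^ Suc n) / of_nat (Suc n)) = scal (1 - tvar ^ Suc n)"
      by (simp only: flip: scal_of_nat scal_mult)
    then show ?thesis
      by (simp add: G_def x_def del: of_nat_Suc power_Suc flip: mult.assoc)
  qed
  have "of_nat n * qfun n = (\<Sum>d=1..n. x d * qfun (n - d))" for n
  proof (cases n)
    case (Suc m)
    have "of_nat (Suc m) * qfun (Suc m) = fps_nth (fps_deriv Q) m"
      by (simp add: q)
    also have "\<dots> = (\<Sum>i=0..m. qfun i * x (Suc (m - i)))"
      by (simp add: deriv fps_mult_nth dG q del: fps_deriv_nth)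
    also have "\<dots> = (\<Sum>d=1..Suc m. x d * qfun (Suc m - d))"
      by (rule sum.reindex_bij_witness[of _ "\<lambda>d. Suc m - d" "\<lambda>i. Suc m - i"]) (auto simp: Suc_diff_le)
    finally show ?thesis by (simp add: Suc)
  qed simp
  moreover have "qfun 0 = 1"
    by (simp add: q Q_def exp_fps_def)
  ultimately show ?thesis
    by (simp add: newton_def x_def)
qed

text \<open>
  Extension by zero to negative indices, under which \<open>H\<^sub>m 1 = q\<^sub>m\<close> for all integers \<open>m\<close>.
\<close>

definition int_seq :: "(nat \<Rightarrow> symfun) \<Rightarrow> int \<Rightarrow> symfun" where
  "int_seq y n = (if n < 0 then 0 else y (nat n))"

lemma lower_coeff_bounded: "\<exists>N. \<forall>j>N. lower_coeff j f = 0"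
proof (induction f rule: symfun_induct)
  case one
  show ?case by (auto simp: lower_coeff_one)
next
  case (scal c f)
  then show ?case by (auto simp: lin_scal[OF lin_lower_coeff])
next
  case (add f g)
  then obtain N M where "\<forall>j>N. lower_coeff j f = 0" "\<forall>j>M. lower_coeff j g = 0" by blast
  then show ?case
    by (intro exI[of _ "max N M"]) (auto simp: lin_add[OF lin_lower_coeff])
next
  case (psum d f)
  then obtain N where "\<forall>j>N. lower_coeff j f = 0" by blast
  then show ?case
    using psum.hyps by (intro exI[of _ "N + d"]) (auto simp: lower_coeff_psum)
qed

lemma H_op_eq_sum:
  assumes "\<forall>j>N. lower_coeff j f = 0"
  shows "H_op m f = (\<Sum>j\<le>N. int_seq qfun (m + int j) * lower_coeff j f)"
  unfolding H_op_def int_seq_def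
  by (rule Sum_any.expand_superset) (use assms not_le in auto)

lemma lin_H_op: "lin (H_op m)"
  unfolding lin_def
proof safe
  fix f g
  obtain N M where NM: "\<forall>j>N. lower_coeff j f = 0" "\<forall>j>M. lower_coeff j g = 0"
    using lower_coeff_bounded by meson
  let ?S = "max N M"
  have "H_op m h = (\<Sum>j\<le>?S. int_seq qfun (m + int j) * lower_coeff j h)" if "h \<in> {f, g, f + g}" for h
    using that NM by (intro H_op_eq_sum) (auto simp: lin_add[OF lin_lower_coeff])
  then show "H_op m (f + g) = H_op m f + H_op m g"
    by (simp add: lin_add[OF lin_lower_coeff] distrib_left sum.distrib)
next
  fix c f
  obtain N where "\<forall>j>N. lower_coeff j f = 0"
    using lower_coeff_bounded by meson
  then show "H_op m (scal c * f) = scal c * H_op m f"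
    by (simp add: H_op_eq_sum[where N = N] lin_scal[OF lin_lower_coeff] sum_distrib_left mult.left_commute)
qed

lemma H_op_one: "H_op m 1 = int_seq qfun m"
  by (subst H_op_eq_sum[of 0]) (auto simp: lower_coeff_one)

text \<open>
  The coefficient of \<open>z\<^sup>m\<close> in \<open>H(z) p\<^sub>d = (p\<^sub>d - z\<^bsup>-d\<^esup>) H(z)\<close>.
\<close>

lemma H_op_psum:
  assumes "d \<ge> 1"
  shows "H_op m (psum d * f) = psum d * H_op m f - H_op (m + int d) f"
proof -
  obtain N where N: "\<forall>j>N. lower_coeff j f = 0"
    using lower_coeff_bounded by meson
  let ?q = "int_seq qfun"
  have "H_op m (psum d * f) = (\<Sum>j\<le>N + d. ?q (m + int j) * lower_coeff j (psum d * f))"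
    using N assms by (intro H_op_eq_sum) (auto simp: lower_coeff_psum)
  also have "\<dots> = psum d * (\<Sum>j\<le>N + d. ?q (m + int j) * lower_coeff j f) -
      (\<Sum>j\<le>N + d. if d \<le> j then ?q (m + int j) * lower_coeff (j - d) f else 0)"
    unfolding lower_coeff_psum[OF assms] sum_distrib_left sum_subtractf[symmetric]
    by (intro sum.cong) (auto simp: algebra_simps)
  also have "(\<Sum>j\<le>N + d. ?q (m + int j) * lower_coeff j f) = H_op m f"
    using N by (intro H_op_eq_sum[symmetric]) auto
  also have "(\<Sum>j\<le>N + d. if d \<le> j then ?q (m + int j) * lower_coeff (j - d) f else 0) =
      (\<Sum>j\<in>{d..N + d}. ?q (m + int j) * lower_coeff (j - d) f)"
    by (rule sum.mono_neutral_cong_right) auto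
  also have "\<dots> = (\<Sum>j\<le>N. ?q (m + int d + int j) * lower_coeff j f)"
    by (rule sum.reindex_bij_witness[of _ "\<lambda>j. j + d" "\<lambda>j. j - d"]) (auto simp: algebra_simps)
  also have "\<dots> = H_op (m + int d) f"
    by (rule H_op_eq_sum[OF N, symmetric])
  finally show ?thesis .
qed

section \<open>The adjoint operators \<open>K\<^sub>m\<close>\<close>

text \<open>
  The ring automorphism \<open>p\<^sub>d \<mapsto> - p\<^sub>d\<close>, on monomials.
\<close>

definition negate_psums :: "symfun \<Rightarrow> symfun" where
  "negate_psums f = (\<Sum>e\<in>Poly_Mapping.keys f. Poly_Mapping.single e
     ((- 1) ^ (\<Sum>i\<in>Poly_Mapping.keys e. Poly_Mapping.lookup e i) * Poly_Mapping.lookup f e))"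

lemma negate_psums_add: "negate_psums (f + g) = negate_psums f + negate_psums g"
  unfolding negate_psums_def by (rule sum_keys_add) (simp_all add: distrib_left single_add)

lemma negate_psums_single:
  "negate_psums (Poly_Mapping.single e c) = Poly_Mapping.single e
     ((- 1) ^ (\<Sum>i\<in>Poly_Mapping.keys e. Poly_Mapping.lookup e i) * c)"
  by (simp add: negate_psums_def)

lemma lin_negate_psums: "lin negate_psums"
proof -
  have "negate_psums (scal c * f) = scal c * negate_psums f" for c f
    by (induction f rule: symfun_single_induct)
      (simp_all add: distrib_left negate_psums_add negate_psums_single scal_times_single mult.left_commute)
  then show ?thesis by (simp add: lin_def negate_psums_add)
qed

lemma negate_psums_one: "negate_psums 1 = 1"
  using negate_psums_single[of 0 1] by simp

lemma negate_psums_psum: "negate_psums (psum d * f) = - (psum d * negate_psums f)"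
proof (induction f rule: symfun_single_induct)
  case (add f g)
  then show ?case by (simp add: distrib_left negate_psums_add)
next
  case (single e c)
  have "(\<Sum>i\<in>Poly_Mapping.keys (e + e'). Poly_Mapping.lookup (e + e') i) =
      (\<Sum>i\<in>Poly_Mapping.keys e. Poly_Mapping.lookup e i) +
      (\<Sum>i\<in>Poly_Mapping.keys e'. Poly_Mapping.lookup e' i)" for e e' :: "nat \<Rightarrow>\<^sub>0 nat"
    by (rule sum_keys_add) simp_all
  then show ?case
    by (simp add: psum_times_single negate_psums_single flip: single_uminus)
qed

lemma negate_psums_negate_psums: "negate_psums (negate_psums f) = f"
  by (induction f rule: symfun_single_induct)
    (simp_all add: negate_psums_add negate_psums_single flip: mult.assoc power_add)

text \<open>
  The coefficients of \<open>exp (- (\<Sum>m\<ge>1. (1 - t\<^sup>m) / m p\<^sub>m z\<^sup>m))\<close>, the inverse of the generating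
  series of the \<open>q\<^sub>m\<close>.
\<close>

definition rfun :: "nat \<Rightarrow> symfun" where
  "rfun n = negate_psums (qfun n)"

lemma newton_rfun: "newton (\<lambda>d. scal (- (1 - tvar ^ d)) * psum d) rfun"
proof -
  note lin = lin_negate_psums
  have "of_nat n * rfun n = (\<Sum>d=1..n. scal (- (1 - tvar ^ d)) * psum d * rfun (n - d))" for n
  proof -
    have "of_nat n * rfun n = negate_psums (of_nat n * qfun n)"
      using lin_scal[OF lin, of "of_nat n" "qfun n"] by (simp add: rfun_def)
    also have "\<dots> = (\<Sum>d=1..n. scal (- (1 - tvar ^ d)) * psum d * rfun (n - d))"
      unfolding newton_rec[OF newton_qfun] lin_sum[OF lin] rfun_def
      by (simp add: mult.assoc lin_scal[OF lin] negate_psums_psum scal_uminus del: minus_diff_eq)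
    finally show ?thesis .
  qed
  moreover have "rfun 0 = 1"
    by (simp add: rfun_def newton_0[OF newton_qfun] negate_psums_one)
  ultimately show ?thesis by (simp add: newton_def)
qed

text \<open>
  The adjoint of \<open>H\<^sub>m\<close> for the scalar product with
  \<open>\<langle>p\<^sub>\<lambda>, p\<^sub>\<mu>\<rangle> = \<delta>\<^bsub>\<lambda>\<mu>\<^esub> z\<^sub>\<lambda> \<Prod>\<^sub>i 1 / (1 - t\<^bsup>\<lambda>\<^sub>i\<^esup>)\<close>. For it, \<open>\<partial>/\<partial>p\<^sub>m\<close> is adjoint to multiplication by
  \<open>(1 - t\<^sup>m) / m p\<^sub>m\<close>, so that the adjoint of \<open>H(w)\<close> is
  \<open>exp (- (\<Sum>m. (1 - t\<^sup>m) / m p\<^sub>m w\<^bsup>-m\<^esup>)) exp (\<Sum>m. \<partial>/\<partial>p\<^sub>m w\<^sup>m)\<close>; this arises from \<open>H(1/w)\<close> by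
  the change of sign of all power sums.
\<close>

definition K_op :: "int \<Rightarrow> symfun \<Rightarrow> symfun" where
  "K_op m f = negate_psums (H_op (- m) (negate_psums f))"

lemma lin_K_op: "lin (K_op m)"
  unfolding K_op_def[abs_def] by (intro lin_comp[OF lin_negate_psums] lin_comp[OF lin_H_op] lin_negate_psums)

lemma K_op_one: "K_op m 1 = int_seq rfun (- m)"
  by (simp add: K_op_def negate_psums_one H_op_one int_seq_def rfun_def lin_0[OF lin_negate_psums])

text \<open>
  The coefficient of \<open>w\<^sup>m\<close> in \<open>K(w) p\<^sub>d = (p\<^sub>d + w\<^sup>d) K(w)\<close>.
\<close>

lemma K_op_psum:
  assumes "d \<ge> 1"
  shows "K_op m (psum d * f) = psum d * K_op m f + K_op (m - int d) f"
  unfolding K_op_def negate_psums_psum lin_uminus[OF lin_H_op] lin_uminus[OF lin_negate_psums]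
    H_op_psum[OF assms] lin_diff[OF lin_negate_psums]
  by simp

text \<open>
  The exponentials of opposite series are inverse to each other, since their product has
  derivative zero.
\<close>

lemma newton_convolution:
  fixes y :: "nat \<Rightarrow> symfun"
  assumes "newton x y" "newton (\<lambda>d. - x d) z"
  shows "(\<Sum>i\<le>n. y i * z (n - i)) = (if n = 0 then 1 else 0)"
proof -
  define Y Z X where "Y = Abs_fps y" and "Z = Abs_fps z" and "X = Abs_fps (\<lambda>d. if d = 0 then 0 else x d)"
  have ode: "fps_X * fps_deriv (Abs_fps u) = Abs_fps (\<lambda>d. if d = 0 then 0 else v d) * Abs_fps u"
    if "newton v u" for u v :: "nat \<Rightarrow> symfun"
  proof (rule fps_ext)
    fix n
    have "fps_nth (fps_X * fps_deriv (Abs_fps u)) n = of_nat n * u n"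
      by (cases n) simp_all
    also have "\<dots> = (\<Sum>d=0..n. (if d = 0 then 0 else v d) * u (n - d))"
      unfolding newton_rec[OF that] by (rule sum.mono_neutral_cong_left) auto
    finally show "fps_nth (fps_X * fps_deriv (Abs_fps u)) n =
        fps_nth (Abs_fps (\<lambda>d. if d = 0 then 0 else v d) * Abs_fps u) n"
      by (simp add: fps_mult_nth)
  qed
  have Y: "fps_X * fps_deriv Y = X * Y"
    using ode[OF assms(1)] by (simp add: X_def Y_def)
  have "Abs_fps (\<lambda>d. if d = 0 then 0 else - x d) = - X"
    by (intro fps_ext) (simp add: X_def)
  then have Z: "fps_X * fps_deriv Z = - X * Z"
    using ode[OF assms(2)] by (simp add: Z_def)
  have "fps_X * fps_deriv (Y * Z) = (fps_X * fps_deriv Y) * Z + Y * (fps_X * fps_deriv Z)"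
    by (simp add: algebra_simps)
  then have "fps_X * fps_deriv (Y * Z) = 0"
    by (simp add: Y Z)
  then have "fps_deriv (Y * Z) = 0"
    by simp
  then have "fps_nth (Y * Z) n = 0" if "n > 0" for n
    using arg_cong[OF \<open>fps_deriv (Y * Z) = 0\<close>, of "\<lambda>F. fps_nth F (n - 1)"] that
    by (cases n) (simp_all del: of_nat_Suc fps_deriv_mult)
  moreover have "(\<Sum>i\<le>n. y i * z (n - i)) = fps_nth (Y * Z) n"
    by (simp add: fps_mult_nth Y_def Z_def atLeast0AtMost)
  moreover have "fps_nth (Y * Z) 0 = 1"
    using newton_0[OF assms(1)] newton_0[OF assms(2)] by (simp add: fps_mult_nth Y_def Z_def)
  ultimately show ?thesis by (cases "n = 0") auto
qed

text \<open>
  Let \<open>T(z)\<close> be the generating series of the \<open>T\<^sub>m\<close>. The assumption says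
  \<open>T(z) p\<^sub>d = (p\<^sub>d + \<epsilon> z\<^bsup>-\<sigma>d\<^esup>) T(z)\<close>, so \<open>T(z)\<close> passes an exponential \<open>Y(u)\<close> in the power sums at
  the expense of a scalar exponential \<open>C\<close>: \<open>T(z) Y(u) = Y(u) C(z\<^bsup>-\<sigma>s\<^esup> u) T(z)\<close>. The induction is
  the product rule: of the factor \<open>n\<close> in front of the \<open>n\<close>-th coefficient of \<open>Y C\<close>, the share
  \<open>n - a\<close> comes from the recursion for \<open>y\<close> and the share \<open>a\<close> from that for \<open>c\<close>.
\<close>

lemma newton_commute:
  fixes T :: "int \<Rightarrow> symfun \<Rightarrow> symfun"
  assumes lin: "\<And>m. lin (T m)"
    and T: "\<And>m d f. d \<ge> 1 \<Longrightarrow> T m (psum d * f) = psum d * T m f + scal \<epsilon> * T (m + \<sigma> * int d) f"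
    and y: "newton (\<lambda>d. scal (e d) * psum (s * d)) y" and "s \<ge> 1"
    and c: "newton (\<lambda>d. \<epsilon> * e d) c"
  shows "T m (y n * f) = (\<Sum>a\<le>n. scal (c a) * y (n - a) * T (m + \<sigma> * int (s * a)) f)"
proof (induction n arbitrary: m rule: less_induct)
  case (less n)
  define U where "U a = T (m + \<sigma> * int (s * a)) f" for a
  show ?case
  proof (cases "n = 0")
    case True
    then show ?thesis by (simp add: newton_0[OF y] newton_0[OF c])
  next
    case False
    have "of_nat n * T m (y n * f) = T m (of_nat n * y n * f)"
      using lin_scal[OF lin, of m "of_nat n" "y n * f"] by (simp add: mult.assoc)
    also have "\<dots> = (\<Sum>d=1..n. scal (e d) * T m (psum (s * d) * (y (n - d) * f)))"
      unfolding newton_rec[OF y] sum_distrib_right lin_sum[OF lin]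
      by (simp add: mult.assoc lin_scal[OF lin])
    also have "\<dots> = (\<Sum>d=1..n. scal (e d) * psum (s * d) * T m (y (n - d) * f)) +
        (\<Sum>d=1..n. scal (\<epsilon> * e d) * T (m + \<sigma> * int (s * d)) (y (n - d) * f))"
      unfolding sum.distrib[symmetric] using \<open>s \<ge> 1\<close>
      by (intro sum.cong refl) (subst T, auto simp: scal_mult distrib_left mult.assoc mult.left_commute)
    also have "(\<Sum>d=1..n. scal (e d) * psum (s * d) * T m (y (n - d) * f)) =
        (\<Sum>d=1..n. \<Sum>a\<le>n - d. scal (e d) * psum (s * d) * (scal (c a) * y (n - d - a) * U a))"
      by (intro sum.cong refl) (use less in \<open>simp add: sum_distrib_left U_def\<close>)
    also have "\<dots> = (\<Sum>a\<le>n. \<Sum>d=1..n - a. scal (e d) * psum (s * d) * (scal (c a) * y (n - d - a) * U a))"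
      by (subst (1 2) sum.Sigma) (auto intro!: sum.reindex_bij_witness[of _ prod.swap prod.swap])
    also have "\<dots> = (\<Sum>a\<le>n. scal (c a) * (of_nat (n - a) * y (n - a)) * U a)"
      unfolding newton_rec[OF y] sum_distrib_left sum_distrib_right
      by (intro sum.cong refl) (simp add: algebra_simps)
    also have "(\<Sum>d=1..n. scal (\<epsilon> * e d) * T (m + \<sigma> * int (s * d)) (y (n - d) * f)) =
        (\<Sum>d=1..n. \<Sum>a\<le>n - d. scal (\<epsilon> * e d) * (scal (c a) * y (n - d - a) * U (d + a)))"
      by (intro sum.cong refl) (use less in \<open>simp add: sum_distrib_left U_def algebra_simps\<close>)
    also have "\<dots> = (\<Sum>b\<le>n. \<Sum>d=1..b. scal (\<epsilon> * e d) * (scal (c (b - d)) * y (n - b) * U b))"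
      by (subst (1 2) sum.Sigma)
        (auto intro!: sum.reindex_bij_witness[of _ "\<lambda>(b, d). (d, b - d)" "\<lambda>(d, a). (d + a, d)"])
    also have "\<dots> = (\<Sum>b\<le>n. scal (of_nat b * c b) * y (n - b) * U b)"
      unfolding newton_rec[OF c] scal_sum sum_distrib_right
      by (intro sum.cong refl) (simp add: scal_mult algebra_simps)
    also have "(\<Sum>a\<le>n. scal (c a) * (of_nat (n - a) * y (n - a)) * U a) +
        (\<Sum>b\<le>n. scal (of_nat b * c b) * y (n - b) * U b) =
        (\<Sum>a\<le>n. of_nat (n - a + a) * (scal (c a) * y (n - a) * U a))"
      unfolding sum.distrib[symmetric] of_nat_add
      by (intro sum.cong refl) (simp add: scal_mult algebra_simps del: of_nat_diff)
    also have "\<dots> = of_nat n * (\<Sum>a\<le>n. scal (c a) * y (n - a) * U a)"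
      unfolding sum_distrib_left by (intro sum.cong refl) (simp del: of_nat_add of_nat_diff)
    finally show ?thesis
      using False by (simp add: U_def)
  qed
qed

text \<open>
  The coefficients of \<open>(1 - \<tau> x) / (1 - x)\<close>.
\<close>

definition c_coeff :: "'a::comm_ring_1 \<Rightarrow> nat \<Rightarrow> 'a" where
  "c_coeff \<tau> a = (if a = 0 then 1 else 1 - \<tau>)"

text \<open>
  The coefficients of the inverse series \<open>(1 - x) / (1 - \<tau> x)\<close>.
\<close>

definition a_coeff :: "'a::comm_ring_1 \<Rightarrow> nat \<Rightarrow> 'a" where
  "a_coeff \<tau> a = (if a = 0 then 1 else \<tau> ^ a - \<tau> ^ (a - 1))"

text \<open>
  \<open>(1 - \<tau> x) / (1 - x) = exp (\<Sum>d\<ge>1. (1 - \<tau>\<^sup>d) x\<^sup>d / d)\<close>.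
\<close>

lemma newton_c_coeff: "newton (\<lambda>d. 1 - \<tau> ^ d) (c_coeff \<tau>)"
proof -
  have "of_nat n * c_coeff \<tau> n = (\<Sum>d=1..n. (1 - \<tau> ^ d) * c_coeff \<tau> (n - d))" for n
  proof (cases n)
    case (Suc j)
    have "(\<Sum>d=1..Suc j. (1 - \<tau> ^ d) * c_coeff \<tau> (Suc j - d)) =
        (1 - \<tau> ^ Suc j) + (\<Sum>d=1..j. (1 - \<tau> ^ d) * (1 - \<tau>))"
      by (subst sum.cl_ivl_Suc) (auto simp: c_coeff_def intro!: sum.cong)
    also have "\<dots> = of_nat (Suc j) * (1 - \<tau>)"
      by (induction j) (simp_all add: algebra_simps)
    finally show ?thesis by (simp add: Suc c_coeff_def)
  qed simp
  then show ?thesis by (simp add: newton_def c_coeff_def)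
qed

lemma newton_a_coeff: "newton (\<lambda>d. - (1 - \<tau> ^ d)) (a_coeff \<tau>)"
proof -
  have "of_nat n * a_coeff \<tau> n = (\<Sum>d=1..n. - (1 - \<tau> ^ d) * a_coeff \<tau> (n - d))" for n
  proof (cases n)
    case (Suc j)
    have summand: "- (1 - \<tau> ^ d) * a_coeff \<tau> (Suc j - d) = (\<tau> - 1) * (\<tau> ^ j - \<tau> ^ (j - d))"
      if "d \<in> {1..j}" for d
    proof -
      have "Suc j - d = Suc (j - d)" "\<tau> ^ j = \<tau> ^ d * \<tau> ^ (j - d)"
        using that by (auto simp flip: power_add)
      then show ?thesis by (simp add: a_coeff_def algebra_simps)
    qed
    have "(\<Sum>d=1..Suc j. - (1 - \<tau> ^ d) * a_coeff \<tau> (Suc j - d)) =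
        (\<Sum>d=1..j. (\<tau> - 1) * (\<tau> ^ j - \<tau> ^ (j - d))) - (1 - \<tau> ^ Suc j)"
      using summand by (simp add: a_coeff_def)
    also have "(\<Sum>d=1..j. (\<tau> - 1) * (\<tau> ^ j - \<tau> ^ (j - d))) =
        of_nat j * ((\<tau> - 1) * \<tau> ^ j) - (\<Sum>d=1..j. (\<tau> - 1) * \<tau> ^ (j - d))"
      by (simp add: right_diff_distrib sum_subtractf)
    also have "(\<Sum>d=1..j. (\<tau> - 1) * \<tau> ^ (j - d)) = (\<Sum>i<j. (\<tau> - 1) * \<tau> ^ i)"
      by (rule sum.reindex_bij_witness[of _ "\<lambda>i. j - i" "\<lambda>d. j - d"]) auto
    also have "\<dots> = \<tau> ^ j - 1"
      by (simp only: power_diff_1_eq sum_distrib_left)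
    finally show ?thesis by (simp add: Suc a_coeff_def algebra_simps)
  qed simp
  then show ?thesis by (simp add: newton_def a_coeff_def)
qed

section \<open>Quadratic relations between the operators\<close>

lemma int_seq_neg [simp]: "n < 0 \<Longrightarrow> int_seq y n = 0"
  and int_seq_int [simp]: "int_seq y (int k) = y k"
  by (simp_all add: int_seq_def)

lemma H_op_q_times:
  "H_op m (qfun n * f) = (\<Sum>a\<le>n. scal (a_coeff tvar a) * qfun (n - a) * H_op (m + int a) f)"
  using newton_commute[where T = H_op and \<epsilon> = "- 1" and \<sigma> = 1 and s = 1 and y = qfun and
      e = "\<lambda>d. 1 - tvar ^ d" and c = "a_coeff tvar" and m = m and n = n and f = f]
    lin_H_op H_op_psum newton_qfun newton_a_coeff[of tvar]
  by (simp add: scal_uminus)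

text \<open>
  Terms with \<open>a > n\<close> vanish, so any sufficiently large upper limit \<open>M\<close> is allowed; this makes it
  possible to compare such sums for neighbouring \<open>m\<close> and \<open>n\<close>.
\<close>

lemma H_op_r:
  assumes "nat n \<le> M"
  shows "H_op m (int_seq rfun n) =
    (\<Sum>a\<le>M. scal (c_coeff tvar a) * int_seq rfun (n - int a) * int_seq qfun (m + int a))"
proof (cases "n < 0")
  case True
  then show ?thesis by (simp add: lin_0[OF lin_H_op])
next
  case False
  then obtain k where k: "n = int k" by (metis nat_eq_iff2 not_less)
  have "H_op m (rfun k * 1) = (\<Sum>a\<le>k. scal (c_coeff tvar a) * rfun (k - a) * H_op (m + int a) 1)"
    using newton_commute[where T = H_op and \<epsilon> = "- 1" and \<sigma> = 1 and s = 1 and y = rfun and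
        e = "\<lambda>d. - (1 - tvar ^ d)" and c = "c_coeff tvar" and m = m and n = k and f = 1]
      lin_H_op H_op_psum newton_rfun newton_c_coeff[of tvar]
    by (simp add: scal_uminus)
  also have "\<dots> = (\<Sum>a\<le>k. scal (c_coeff tvar a) * int_seq rfun (n - int a) * int_seq qfun (m + int a))"
    by (intro sum.cong refl) (simp add: H_op_one k flip: of_nat_diff)
  also have "\<dots> = (\<Sum>a\<le>M. scal (c_coeff tvar a) * int_seq rfun (n - int a) * int_seq qfun (m + int a))"
    using assms by (intro sum.mono_neutral_left) (auto simp: k)
  finally show ?thesis by (simp add: k)
qed

lemma K_op_int_seq:
  assumes "newton (\<lambda>d. scal (e d) * psum d) y" "newton e c" "nat n \<le> M"
  shows "K_op m (int_seq y n) =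
    (\<Sum>a\<le>M. scal (c a) * int_seq y (n - int a) * int_seq rfun (int a - m))"
proof (cases "n < 0")
  case True
  then show ?thesis by (simp add: lin_0[OF lin_K_op])
next
  case False
  then obtain k where k: "n = int k" by (metis nat_eq_iff2 not_less)
  have "K_op m (y k * 1) = (\<Sum>a\<le>k. scal (c a) * y (k - a) * K_op (m - int a) 1)"
    using newton_commute[where T = K_op and \<epsilon> = 1 and \<sigma> = "- 1" and s = 1 and y = y and
        e = e and c = c and m = m and n = k and f = 1]
      lin_K_op K_op_psum assms by simp
  also have "\<dots> = (\<Sum>a\<le>k. scal (c a) * int_seq y (n - int a) * int_seq rfun (int a - m))"
    by (intro sum.cong refl) (simp add: K_op_one k flip: of_nat_diff)
  also have "\<dots> = (\<Sum>a\<le>M. scal (c a) * int_seq y (n - int a) * int_seq rfun (int a - m))"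
    using assms(3) by (intro sum.mono_neutral_left) (auto simp: k)
  finally show ?thesis by (simp add: k)
qed

lemmas K_op_r = K_op_int_seq[OF newton_rfun newton_a_coeff]
lemmas K_op_q = K_op_int_seq[OF newton_qfun newton_c_coeff]

text \<open>
  With \<open>r\<^bsub>-m\<^esub> = K\<^sub>m 1\<close> this is one half of the quadratic relation at \<open>1\<close>. Multiplying the weights
  \<open>(1 - x) / (1 - t x)\<close> by \<open>1 - t x\<close> leaves only two terms, and these change sign when
  \<open>(m, n)\<close> is replaced by \<open>(1 - n, 1 - m)\<close>.
\<close>

lemma K_op_quadratic_one:
  "K_op m (int_seq rfun n) - scal tvar * K_op (m - 1) (int_seq rfun (n - 1)) =
    int_seq rfun n * int_seq rfun (- m) - int_seq rfun (n - 1) * int_seq rfun (1 - m)"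
proof -
  let ?r = "int_seq rfun" and ?a = "\<lambda>a. scal (a_coeff tvar a)"
  define M where "M = nat n"
  have a: "?a (Suc a) - scal tvar * ?a a = (if a = 0 then - 1 else 0)" for a
    by (cases a) (simp_all add: a_coeff_def scal_diff algebra_simps flip: scal_mult)
  have "K_op m (?r n) = (\<Sum>a\<le>Suc M. ?a a * ?r (n - int a) * ?r (int a - m))"
    by (rule K_op_r) (simp add: M_def)
  also have "\<dots> = ?r n * ?r (- m) + (\<Sum>a\<le>M. ?a (Suc a) * (?r (n - 1 - int a) * ?r (int a - (m - 1))))"
    by (subst sum.atMost_Suc_shift) (simp add: a_coeff_def algebra_simps)
  finally have 1: "K_op m (?r n) = \<dots>" .
  have "K_op (m - 1) (?r (n - 1)) = (\<Sum>a\<le>M. ?a a * ?r (n - 1 - int a) * ?r (int a - (m - 1)))"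
    by (rule K_op_r) (simp add: M_def)
  then have 2: "scal tvar * K_op (m - 1) (?r (n - 1)) =
      (\<Sum>a\<le>M. scal tvar * ?a a * (?r (n - 1 - int a) * ?r (int a - (m - 1))))"
    by (simp add: sum_distrib_left mult.assoc)
  have "K_op m (?r n) - scal tvar * K_op (m - 1) (?r (n - 1)) = ?r n * ?r (- m) +
      (\<Sum>a\<le>M. (?a (Suc a) - scal tvar * ?a a) * (?r (n - 1 - int a) * ?r (int a - (m - 1))))"
    unfolding 1 2 left_diff_distrib sum_subtractf by simp
  also have "\<dots> = ?r n * ?r (- m) +
      (\<Sum>a\<le>M. if a = 0 then - (?r (n - 1) * ?r (1 - m)) else 0)"
    unfolding a by (intro arg_cong2[where f = "(+)"] refl sum.cong) simp
  finally show ?thesis by simp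
qed

text \<open>
  The coefficient of \<open>v\<^sup>m w\<^sup>n\<close> in \<open>(w - t v) K(v) K(w) + (v - t w) K(w) K(v) = 0\<close>. Passing \<open>p\<^sub>d\<close>
  multiplies the left-hand side by \<open>p\<^sub>d + v\<^sup>d + w\<^sup>d\<close>, hence it suffices to know the relation at
  \<open>1\<close>.
\<close>

lemma K_op_quadratic:
  "K_op m (K_op (n - 1) f) - scal tvar * K_op (m - 1) (K_op n f)
   + K_op n (K_op (m - 1) f) - scal tvar * K_op (n - 1) (K_op m f) = 0"
proof (induction f arbitrary: m n rule: symfun_induct)
  case one
  have "K_op m (K_op (n - 1) 1) - scal tvar * K_op (m - 1) (K_op n 1)
     + K_op n (K_op (m - 1) 1) - scal tvar * K_op (n - 1) (K_op m 1) =
     (K_op m (int_seq rfun (1 - n)) - scal tvar * K_op (m - 1) (int_seq rfun (1 - n - 1)))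
     + (K_op n (int_seq rfun (1 - m)) - scal tvar * K_op (n - 1) (int_seq rfun (1 - m - 1)))"
    by (simp add: K_op_one)
  also have "\<dots> = 0"
    unfolding K_op_quadratic_one by simp
  finally show ?case .
next
  case (scal c f)
  have "scal c * (K_op m (K_op (n - 1) f) - scal tvar * K_op (m - 1) (K_op n f)
     + K_op n (K_op (m - 1) f) - scal tvar * K_op (n - 1) (K_op m f)) = 0"
    by (simp add: scal)
  then show ?case
    unfolding lin_scal[OF lin_K_op] by (simp add: algebra_simps)
next
  case (add f g)
  show ?case using add[of m n] by (simp add: lin_add[OF lin_K_op] algebra_simps)
next
  case (psum d f)
  define X where "X m n = K_op m (K_op (n - 1) f) - scal tvar * K_op (m - 1) (K_op n f)
     + K_op n (K_op (m - 1) f) - scal tvar * K_op (n - 1) (K_op m f)" for m n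
  have "K_op m (K_op (n - 1) (psum d * f)) - scal tvar * K_op (m - 1) (K_op n (psum d * f))
     + K_op n (K_op (m - 1) (psum d * f)) - scal tvar * K_op (n - 1) (K_op m (psum d * f)) =
     psum d * X m n + X (m - int d) n + X m (n - int d)"
    unfolding K_op_psum[OF psum.hyps] lin_add[OF lin_K_op] X_def by (simp add: algebra_simps)
  then show ?case using psum.IH by (simp add: X_def)
qed

lemma K_op_exchange:
  "K_op b (K_op a f) = scal tvar * K_op (b - 1) (K_op (a + 1) f) - K_op (a + 1) (K_op (b - 1) f)
    + scal tvar * K_op a (K_op b f)"
  using K_op_quadratic[of b "a + 1" f] by (simp add: algebra_simps)

lemma H_op_eq_K_op: "H_op m f = negate_psums (K_op (- m) (negate_psums f))"
  by (simp add: K_op_def negate_psums_negate_psums)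

text \<open>
  Conjugation by \<open>p\<^sub>d \<mapsto> - p\<^sub>d\<close> exchanges \<open>H\<^sub>m\<close> and \<open>K\<^bsub>-m\<^esub>\<close>, so the relation between the \<open>K\<^sub>m\<close>
  is also one between the \<open>H\<^sub>m\<close>.
\<close>

lemma H_op_exchange:
  "H_op a (H_op b f) = scal tvar * H_op (a + 1) (H_op (b - 1) f) - H_op (b - 1) (H_op (a + 1) f)
    + scal tvar * H_op b (H_op a f)"
  using arg_cong[OF K_op_exchange[of "- a" "- b" "negate_psums f"], of negate_psums]
  by (simp add: H_op_eq_K_op negate_psums_negate_psums lin_add[OF lin_negate_psums]
      lin_diff[OF lin_negate_psums] lin_scal[OF lin_negate_psums])

text \<open>
  The generating series of the \<open>q\<^sub>i\<close> and the \<open>r\<^sub>i\<close> are inverse to each other. The convolution is cut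
  at the summand \<open>q\<^sub>n r\<^bsub>-m\<^esub>\<close>: the part on one side of it enters \<open>K\<^sub>m H\<^sub>n 1\<close>, the part on the other
  side \<open>H\<^sub>n K\<^sub>m 1\<close>.
\<close>

lemma qr_convolution:
  assumes "nat \<bar>m\<bar> + nat \<bar>n\<bar> \<le> M"
  shows "(\<Sum>a=1..M. int_seq qfun (n - int a) * int_seq rfun (int a - m))
    + int_seq qfun n * int_seq rfun (- m)
    + (\<Sum>a=1..M. int_seq qfun (n + int a) * int_seq rfun (- m - int a)) = (if m = n then 1 else 0)"
    (is "?A + ?B + ?C = _")
proof -
  define u where "u b = int_seq qfun (n + b) * int_seq rfun (- m - b)" for b
  have "?A = (\<Sum>b\<in>{- int M..<0}. u b)"
    unfolding u_def
    by (rule sum.reindex_bij_witness[of _ "\<lambda>b. nat (- b)" "\<lambda>a. - int a"]) auto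
  moreover have "?C = (\<Sum>b\<in>{0<..int M}. u b)"
    unfolding u_def by (rule sum.reindex_bij_witness[of _ nat int]) auto
  moreover have "(\<Sum>b\<in>{- int M..int M}. u b) = (\<Sum>b\<in>{- int M..<0} \<union> {0} \<union> {0<..int M}. u b)"
    by (intro sum.cong) auto
  then have "(\<Sum>b\<in>{- int M..int M}. u b) =
      (\<Sum>b\<in>{- int M..<0}. u b) + u 0 + (\<Sum>b\<in>{0<..int M}. u b)"
    by (subst (asm) sum.union_disjoint, auto)+
  ultimately have "?A + ?B + ?C = (\<Sum>b\<in>{- int M..int M}. u b)"
    by (simp add: u_def)
  also have "\<dots> = (\<Sum>b\<in>{- n..- m}. u b)"
    using assms by (intro sum.mono_neutral_right) (auto simp: u_def int_seq_def)
  also have "\<dots> = (if m = n then 1 else 0)"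
  proof (cases "n < m")
    case True
    then show ?thesis by simp
  next
    case False
    have "newton (\<lambda>d. - (scal (1 - tvar ^ d) * psum d)) rfun"
      using newton_rfun by (simp add: scal_uminus del: minus_diff_eq)
    then have conv: "(\<Sum>i\<le>k. qfun i * rfun (k - i)) = (if k = 0 then 1 else 0)" for k
      by (rule newton_convolution[OF newton_qfun])
    have u: "u b = qfun (nat (n + b)) * rfun (nat (n - m) - nat (n + b))" if "b \<in> {- n..- m}" for b
    proof -
      have "nat (n - m) - nat (n + b) = nat (- m - b)"
        using that by auto
      then show ?thesis using that by (simp add: u_def int_seq_def)
    qed
    have "(\<Sum>b\<in>{- n..- m}. u b) = (\<Sum>i\<le>nat (n - m). qfun i * rfun (nat (n - m) - i))"
      by (rule sum.reindex_bij_witness[of _ "\<lambda>i. int i - n" "\<lambda>b. nat (n + b)"])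
        (use False u in auto)
    then show ?thesis using False by (auto simp: conv)
  qed
  finally show ?thesis .
qed

lemma sum_c_coeff:
  "(\<Sum>a\<le>M. scal (c_coeff tvar a) * u a) = u 0 + (1 - scal tvar) * (\<Sum>a=1..M. u a)"
proof -
  have "{..M} = insert 0 {1..M}" by auto
  then show ?thesis by (simp add: c_coeff_def scal_diff sum_distrib_left)
qed

lemma K_op_H_op_one:
  assumes "nat n \<le> M"
  shows "K_op m (H_op n 1) = int_seq qfun n * int_seq rfun (- m)
    + (1 - scal tvar) * (\<Sum>a=1..M. int_seq qfun (n - int a) * int_seq rfun (int a - m))"
  unfolding H_op_one K_op_q[OF assms] mult.assoc sum_c_coeff by simp

lemma H_op_K_op_one:
  assumes "nat (- m) \<le> M"
  shows "H_op n (K_op m 1) = int_seq qfun n * int_seq rfun (- m)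
    + (1 - scal tvar) * (\<Sum>a=1..M. int_seq qfun (n + int a) * int_seq rfun (- m - int a))"
  unfolding K_op_one H_op_r[OF assms] mult.assoc sum_c_coeff by (simp add: mult.commute)

text \<open>
  With \<open>x = w z\<close>, both products have the same normally ordered form up to a factor:
  \<open>(1 - t x) / (1 - x)\<close>, expanded in powers of \<open>x\<close>, for \<open>K(w) H(z)\<close>, and
  \<open>(1 - t / x) / (1 - 1 / x)\<close>, expanded in powers of \<open>1 / x\<close>, for \<open>H(z) K(w)\<close>. Clearing
  denominators therefore leaves a multiple of the delta series:
  \<open>(1 - t x) H(z) K(w) - (t - x) K(w) H(z) = (1 - t)\<^sup>2 \<delta>(x)\<close>.
\<close>

lemma K_op_H_op_exchange:
  "K_op m (H_op n f) - scal tvar * K_op (m + 1) (H_op (n + 1) f) =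
    scal tvar * H_op n (K_op m f) - H_op (n + 1) (K_op (m + 1) f)
    + (if m = n then (1 - scal tvar)\<^sup>2 * f else 0)"
proof (induction f arbitrary: m n rule: symfun_induct)
  case one
  define M where "M = nat \<bar>m\<bar> + nat \<bar>n\<bar>"
  define u where "u b = int_seq qfun (n + b) * int_seq rfun (- m - b)" for b
  define P where "P = (\<Sum>a=1..Suc M. u (- int a))"
  define S where "S = (\<Sum>a=1..Suc M. u (int a))"
  have KH: "K_op m (H_op n 1) = u 0 + (1 - scal tvar) * P"
    using K_op_H_op_one[of n "Suc M" m] by (simp add: u_def P_def M_def)
  have u1: "int_seq qfun (n + 1) * int_seq rfun (- (m + 1)) = u 1"
    by (simp add: u_def)
  have "K_op (m + 1) (H_op (n + 1) 1) = u 1 + (1 - scal tvar) *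
      (\<Sum>a=1..Suc (Suc M). int_seq qfun (n + 1 - int a) * int_seq rfun (int a - (m + 1)))"
    unfolding u1[symmetric] by (rule K_op_H_op_one) (simp add: M_def)
  also have "(\<Sum>a=1..Suc (Suc M). int_seq qfun (n + 1 - int a) * int_seq rfun (int a - (m + 1))) =
      (\<Sum>a=1..Suc (Suc M). u (1 - int a))"
    by (intro sum.cong refl) (simp add: u_def algebra_simps)
  also have "\<dots> = u 0 + P"
    using sum.shift_bounds_cl_Suc_ivl[of "\<lambda>a. u (1 - int a)" 0 "Suc M"]
      sum.atLeast_Suc_atMost[of 0 "Suc M" "\<lambda>a. u (- int a)"]
    by (simp add: P_def del: sum.cl_ivl_Suc)
  finally have KH': "K_op (m + 1) (H_op (n + 1) 1) = u 1 + (1 - scal tvar) * (u 0 + P)" .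
  have HK: "H_op n (K_op m 1) = u 0 + (1 - scal tvar) * S"
    using H_op_K_op_one[of m "Suc M" n] by (simp add: u_def S_def M_def)
  have "H_op (n + 1) (K_op (m + 1) 1) = u 1 + (1 - scal tvar) *
      (\<Sum>a=1..M. int_seq qfun (n + 1 + int a) * int_seq rfun (- (m + 1) - int a))"
    unfolding u1[symmetric] by (rule H_op_K_op_one) (simp add: M_def)
  also have "(\<Sum>a=1..M. int_seq qfun (n + 1 + int a) * int_seq rfun (- (m + 1) - int a)) =
      (\<Sum>a=1..M. u (1 + int a))"
    by (intro sum.cong refl) (simp add: u_def add.assoc diff_diff_eq[symmetric])
  also have "\<dots> = S - u 1"
    using sum.shift_bounds_cl_Suc_ivl[of "\<lambda>a. u (int a)" 1 M]
      sum.atLeast_Suc_atMost[of 1 "Suc M" "\<lambda>a. u (int a)"]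
    by (simp add: S_def del: sum.cl_ivl_Suc)
  finally have HK': "H_op (n + 1) (K_op (m + 1) 1) = u 1 + (1 - scal tvar) * (S - u 1)" .
  have "P + u 0 + S = (if m = n then 1 else 0)"
    using qr_convolution[of m n "Suc M"] by (simp add: P_def S_def u_def M_def)
  then have total: "(if m = n then (1 - scal tvar)\<^sup>2 * 1 else 0) = (1 - scal tvar)\<^sup>2 * (P + u 0 + S)"
    by simp
  then show ?case
    unfolding KH KH' HK HK' total by (simp add: algebra_simps power2_eq_square)
next
  case (scal c f)
  have "scal c * (K_op m (H_op n f) - scal tvar * K_op (m + 1) (H_op (n + 1) f)) =
    scal c * (scal tvar * H_op n (K_op m f) - H_op (n + 1) (K_op (m + 1) f)
    + (if m = n then (1 - scal tvar)\<^sup>2 * f else 0))"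
    by (simp only: scal)
  then show ?case
    unfolding lin_scal[OF lin_K_op] lin_scal[OF lin_H_op]
    by (simp add: algebra_simps split: if_splits)
next
  case (add f g)
  show ?case using add[of m n]
    by (simp add: lin_add[OF lin_K_op] lin_add[OF lin_H_op] algebra_simps split: if_splits)
next
  case (psum d f)
  define Z where "Z m n = K_op m (H_op n f) - scal tvar * K_op (m + 1) (H_op (n + 1) f) -
    scal tvar * H_op n (K_op m f) + H_op (n + 1) (K_op (m + 1) f)" for m n
  have Z: "Z m n = (if m = n then (1 - scal tvar)\<^sup>2 * f else 0)" for m n
    using psum.IH[of m n] by (simp add: Z_def algebra_simps)
  have "K_op m (H_op n (psum d * f)) - scal tvar * K_op (m + 1) (H_op (n + 1) (psum d * f)) -
    scal tvar * H_op n (K_op m (psum d * f)) + H_op (n + 1) (K_op (m + 1) (psum d * f)) =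
    psum d * Z m n + Z (m - int d) n - Z m (n + int d)"
    unfolding K_op_psum[OF psum.hyps] H_op_psum[OF psum.hyps] lin_add[OF lin_K_op]
      lin_add[OF lin_H_op] lin_diff[OF lin_K_op] Z_def
    by (simp add: algebra_simps)
  also have "\<dots> = (if m = n then (1 - scal tvar)\<^sup>2 * (psum d * f) else 0)"
    unfolding Z by (simp add: algebra_simps)
  finally show ?case by (simp add: algebra_simps)
qed

text \<open>
  The preceding relation relates consecutive values of \<open>K\<^bsub>m+j\<^esub> H\<^bsub>n+j\<^esub> f\<close> only; this is the
  boundary value from which they can be computed by descending \<open>j\<close>. At \<open>f = 1\<close> it holds as soon as
  \<open>m + j > 0\<close>, because then one side of the cut convolution carries all nonzero terms.
\<close>

lemma K_op_H_op_eventually: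
  "\<exists>N. \<forall>j\<ge>N. K_op (m + int j) (H_op (n + int j) f) = (if m = n then (1 - scal tvar) * f else 0)"
proof (induction f arbitrary: m n rule: symfun_induct)
  case one
  have "K_op m' (H_op n' 1) = (if m' = n' then (1 - scal tvar) * 1 else 0)" if "m' \<ge> 1" for m' n'
    using that K_op_H_op_one[of n' "nat \<bar>m'\<bar> + nat \<bar>n'\<bar>" m']
      qr_convolution[of m' n' "nat \<bar>m'\<bar> + nat \<bar>n'\<bar>"] by simp
  from this[of "m + int _" "n + int _"] show ?case
    by (intro exI[of _ "nat (1 - m)"]) auto
next
  case (scal c f)
  obtain N where "\<forall>j\<ge>N. K_op (m + int j) (H_op (n + int j) f) =
      (if m = n then (1 - scal tvar) * f else 0)"
    using scal by blast
  then show ?case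
    by (intro exI[of _ N]) (auto simp: lin_scal[OF lin_K_op] lin_scal[OF lin_H_op])
next
  case (add f g)
  obtain N M where "\<forall>j\<ge>N. K_op (m + int j) (H_op (n + int j) f) =
      (if m = n then (1 - scal tvar) * f else 0)"
    "\<forall>j\<ge>M. K_op (m + int j) (H_op (n + int j) g) =
      (if m = n then (1 - scal tvar) * g else 0)"
    using add by meson
  then show ?case
    by (intro exI[of _ "max N M"]) (auto simp: lin_add[OF lin_K_op] lin_add[OF lin_H_op] distrib_left)
next
  case (psum d f)
  define E where "E m n j \<longleftrightarrow> K_op (m + int j) (H_op (n + int j) f) =
    (if m = n then (1 - scal tvar) * f else 0)" for m n j
  have "\<exists>N. \<forall>j\<ge>N. E m n j" for m n
    unfolding E_def by (rule psum.IH)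
  from this[of m n] this[of "m - int d" n] this[of m "n + int d"] obtain N1 N2 N3 where
    N: "\<forall>j\<ge>N1. E m n j" "\<forall>j\<ge>N2. E (m - int d) n j" "\<forall>j\<ge>N3. E m (n + int d) j"
    by blast
  have "K_op (m + int j) (H_op (n + int j) (psum d * f)) =
      (if m = n then (1 - scal tvar) * (psum d * f) else 0)" if "j \<ge> N1 + N2 + N3" for j
  proof -
    have "E m n j" "E (m - int d) n j" "E m (n + int d) j"
      using N that by auto
    moreover have "K_op (m + int j) (H_op (n + int j) (psum d * f)) =
      psum d * K_op (m + int j) (H_op (n + int j) f) + K_op (m - int d + int j) (H_op (n + int j) f)
      - K_op (m + int j) (H_op (n + int d + int j) f)"
      unfolding K_op_psum[OF psum.hyps] H_op_psum[OF psum.hyps] lin_diff[OF lin_K_op]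
      by (simp add: algebra_simps)
    ultimately show ?thesis
      unfolding E_def by (simp add: algebra_simps)
  qed
  then show ?case by blast
qed

text \<open>
  The hypothesis removes the products \<open>H K\<close> with positive shift from the exchange relation, so
  that the value \<open>(1 - t) \<delta> \<psi>(f)\<close> of \<open>\<psi>(K\<^bsub>m+j\<^esub> H\<^bsub>n+j\<^esub> f)\<close> for large \<open>j\<close> persists down to
  \<open>j = 1\<close>, and the step from \<open>1\<close> to \<open>0\<close> is the claim. The functional \<open>\<psi>\<close> covers two situations:
  \<open>f\<close> is annihilated by the higher \<open>K\<close>, or \<open>\<psi>\<close> annihilates the image of the higher \<open>H\<close>.
\<close>

lemma K_op_H_op_reorder:
  assumes "lin \<psi>" and zero: "\<And>j. j \<ge> 1 \<Longrightarrow> \<psi> (H_op (n + int j) (K_op (m + int j) f)) = 0"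
  shows "\<psi> (K_op m (H_op n f)) = scal tvar * \<psi> (H_op n (K_op m f))
    + (if m = n then (1 - scal tvar) * \<psi> f else 0)"
proof -
  define x where "x j = \<psi> (K_op (m + int j) (H_op (n + int j) f))" for j
  define \<delta> where "\<delta> = (if m = n then \<psi> f else 0)"
  have scal1: "\<psi> ((1 - scal tvar) * g) = (1 - scal tvar) * \<psi> g" for g
    using lin_scal[OF \<open>lin \<psi>\<close>, of "1 - tvar"] by (simp add: scal_diff)
  have step: "x j = scal tvar * x (Suc j) + scal tvar * \<psi> (H_op (n + int j) (K_op (m + int j) f))
      + (1 - scal tvar)\<^sup>2 * \<delta>" for j
  proof -
    have "\<psi> (K_op (m + int j) (H_op (n + int j) f)
        - scal tvar * K_op (m + int j + 1) (H_op (n + int j + 1) f)) =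
      \<psi> (scal tvar * H_op (n + int j) (K_op (m + int j) f) - H_op (n + int j + 1) (K_op (m + int j + 1) f)
        + (if m + int j = n + int j then (1 - scal tvar)\<^sup>2 * f else 0))"
      by (simp only: K_op_H_op_exchange)
    moreover have "\<psi> (H_op (n + int j + 1) (K_op (m + int j + 1) f)) = 0"
      using zero[of "Suc j"] by (simp add: algebra_simps)
    moreover have "\<psi> (if m + int j = n + int j then (1 - scal tvar)\<^sup>2 * f else 0) = (1 - scal tvar)\<^sup>2 * \<delta>"
      by (simp add: \<delta>_def power2_eq_square mult.assoc scal1 lin_0[OF \<open>lin \<psi>\<close>])
    ultimately show ?thesis
      by (simp add: x_def lin_diff[OF \<open>lin \<psi>\<close>] lin_add[OF \<open>lin \<psi>\<close>] lin_scal[OF \<open>lin \<psi>\<close>] algebra_simps)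
  qed
  obtain N where "\<forall>j\<ge>N. K_op (m + int j) (H_op (n + int j) f) = (if m = n then (1 - scal tvar) * f else 0)"
    using K_op_H_op_eventually[of m n f] by blast
  then have N: "x j = (1 - scal tvar) * \<delta>" if "j \<ge> N" for j
    using that by (simp add: x_def \<delta>_def scal1 lin_0[OF \<open>lin \<psi>\<close>])
  have "x j = (1 - scal tvar) * \<delta>" if "j \<ge> 1" "N \<le> j + k" for j k
    using that
  proof (induction k arbitrary: j)
    case (Suc k)
    have "x (Suc j) = (1 - scal tvar) * \<delta>"
      by (rule Suc.IH) (use Suc.prems in auto)
    then have "x j = scal tvar * ((1 - scal tvar) * \<delta>) + (1 - scal tvar)\<^sup>2 * \<delta>"
      using step[of j] zero[of j] Suc.prems by simp
    then show ?case
      by (simp add: algebra_simps power2_eq_square)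
  qed (use N in auto)
  from this[of 1 N] have "x 1 = (1 - scal tvar) * \<delta>" by simp
  then have "x 0 = scal tvar * ((1 - scal tvar) * \<delta>) + scal tvar * \<psi> (H_op n (K_op m f))
      + (1 - scal tvar)\<^sup>2 * \<delta>"
    using step[of 0] by simp
  also have "\<dots> = scal tvar * \<psi> (H_op n (K_op m f)) + (1 - scal tvar) * \<delta>"
    by (simp add: algebra_simps power2_eq_square)
  finally show ?thesis
    by (simp add: x_def \<delta>_def)
qed

section \<open>The plethysm of a power sum with \<open>q\<^sub>k\<close>\<close>

lemma subst_t_add:
  assumes "s \<ge> 1" shows "subst_t s (x + y) = subst_t s x + subst_t s y"
proof (cases x, cases y)
  fix a b c d assume "x = Fraction_Field.Fract a b" "b \<noteq> 0" "y = Fraction_Field.Fract c d" "d \<noteq> 0"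
  then show ?thesis
    using assms by (simp add: subst_t_Fract pcompose_monom_eq_0_iff pcompose_add pcompose_mult)
qed

lemma subst_t_mult:
  assumes "s \<ge> 1" shows "subst_t s (x * y) = subst_t s x * subst_t s y"
proof (cases x, cases y)
  fix a b c d assume "x = Fraction_Field.Fract a b" "b \<noteq> 0" "y = Fraction_Field.Fract c d" "d \<noteq> 0"
  then show ?thesis
    using assms by (simp add: subst_t_Fract pcompose_mult)
qed

lemma subst_t_0: "s \<ge> 1 \<Longrightarrow> subst_t s 0 = 0"
  using subst_t_add[of s 0 0] by simp

lemma subst_t_1: "s \<ge> 1 \<Longrightarrow> subst_t s 1 = 1"
  by (simp add: One_fract_def subst_t_Fract pcompose_1)

lemma subst_t_diff: "s \<ge> 1 \<Longrightarrow> subst_t s (x - y) = subst_t s x - subst_t s y"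
  using subst_t_add[of s "x - y" y] by simp

lemma Fract_power: "Fraction_Field.Fract a 1 ^ n = Fraction_Field.Fract (a ^ n) 1"
  by (induction n) (simp_all add: One_fract_def)

lemma subst_t_tvar_power:
  assumes "s \<ge> 1" shows "subst_t s (tvar ^ d) = (tvar ^ s) ^ d"
proof (induction d)
  case (Suc d)
  have "pcompose [:0, 1:] (monom 1 s) = ([:0, 1:] :: rat poly) ^ s"
    by (simp add: pcompose_pCons monom_altdef)
  then have "subst_t s tvar = tvar ^ s"
    using assms by (simp add: tvar_def subst_t_Fract Fract_power pcompose_1)
  then show ?case
    using Suc by (simp add: subst_t_mult[OF assms])
qed (simp add: subst_t_1[OF assms])

lemma power_subst_add:
  assumes "s \<ge> 1" shows "power_subst s (f + g) = power_subst s f + power_subst s g"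
  unfolding power_subst_def
  by (rule sum_keys_add) (simp_all add: subst_t_0[OF assms] subst_t_add[OF assms] scal_add distrib_right)

lemma power_subst_single:
  assumes "s \<ge> 1"
  shows "power_subst s (Poly_Mapping.single e c) = scal (subst_t s c) *
    (\<Prod>i\<in>Poly_Mapping.keys e. psum (s * Suc i) ^ Poly_Mapping.lookup e i)"
  by (simp add: power_subst_def subst_t_0[OF assms])

lemma power_subst_scal:
  assumes "s \<ge> 1" shows "power_subst s (scal c * f) = scal (subst_t s c) * power_subst s f"
  by (induction f rule: symfun_single_induct)
    (simp_all add: distrib_left power_subst_add[OF assms] power_subst_single[OF assms]
      scal_times_single subst_t_mult[OF assms] scal_mult mult.assoc)

lemma power_subst_sum:
  assumes "s \<ge> 1" shows "power_subst s (\<Sum>x\<in>A. f x) = (\<Sum>x\<in>A. power_subst s (f x))"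
proof -
  have "power_subst s 0 = 0" by (simp add: power_subst_def)
  then show ?thesis
    by (induction A rule: infinite_finite_induct) (simp_all add: power_subst_add[OF assms])
qed

lemma power_subst_of_nat:
  assumes "s \<ge> 1" shows "power_subst s (of_nat n * f) = of_nat n * power_subst s f"
proof -
  have "power_subst s 0 = 0" by (simp add: power_subst_def)
  then show ?thesis
    by (induction n) (simp_all add: power_subst_add[OF assms] distrib_right)
qed

lemma power_subst_psum:
  assumes "s \<ge> 1" "d \<ge> 1" shows "power_subst s (psum d * f) = psum (s * d) * power_subst s f"
proof (induction f rule: symfun_single_induct)
  case (add f g)
  then show ?case by (simp add: distrib_left power_subst_add[OF assms(1)])
next
  case (single e c)
  define A where "A = insert (d - 1) (Poly_Mapping.keys e)"
  have sd: "Suc (d - Suc 0) = d"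
    using assms by simp
  let ?e' = "e + Poly_Mapping.single (d - 1) 1"
  have ext: "(\<Prod>i\<in>Poly_Mapping.keys e'. psum (s * Suc i) ^ Poly_Mapping.lookup e' i) =
      (\<Prod>i\<in>A. psum (s * Suc i) ^ Poly_Mapping.lookup e' i)" if "Poly_Mapping.keys e' \<subseteq> A" for e'
    using that by (intro prod.mono_neutral_left) (auto simp: A_def in_keys_iff)
  have "Poly_Mapping.keys ?e' \<subseteq> A"
    using keys_add[of e "Poly_Mapping.single (d - 1) 1"] by (auto simp: A_def)
  then have "(\<Prod>i\<in>Poly_Mapping.keys ?e'. psum (s * Suc i) ^ Poly_Mapping.lookup ?e' i) =
      (\<Prod>i\<in>A. psum (s * Suc i) ^ Poly_Mapping.lookup e i) *
      (\<Prod>i\<in>A. psum (s * Suc i) ^ Poly_Mapping.lookup (Poly_Mapping.single (d - 1) (1::nat)) i)"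
    by (subst ext) (simp_all add: lookup_add power_add prod.distrib)
  also have "(\<Prod>i\<in>A. psum (s * Suc i) ^ Poly_Mapping.lookup (Poly_Mapping.single (d - 1) (1::nat)) i) =
      (\<Prod>i\<in>A. if i = d - 1 then psum (s * d) else 1)"
    by (intro prod.cong refl) (simp add: lookup_single when_def sd del: mult_Suc_right)
  also have "\<dots> = psum (s * d)"
    by (simp add: A_def)
  also have "(\<Prod>i\<in>A. psum (s * Suc i) ^ Poly_Mapping.lookup e i) =
      (\<Prod>i\<in>Poly_Mapping.keys e. psum (s * Suc i) ^ Poly_Mapping.lookup e i)"
    by (rule ext[symmetric]) (auto simp: A_def)
  finally show ?case
    by (simp add: psum_times_single power_subst_single[OF assms(1)] mult_ac)
qed

lemma power_subst_one: "s \<ge> 1 \<Longrightarrow> power_subst s 1 = 1"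
  using power_subst_single[of s 0 1] subst_t_1[of s] by simp

lemma psum_plethysm:
  assumes "s \<ge> 1" shows "psum s \<diamondop> f = power_subst s f"
  by (simp add: plethysm_def psum_def Suc_pred' assms[unfolded One_nat_def Suc_le_eq])

text \<open>
  The substitution \<open>p\<^sub>d \<mapsto> p\<^bsub>sd\<^esub>\<close>, \<open>t \<mapsto> t\<^sup>s\<close> carries the recursion for the \<open>q\<^sub>k\<close> to one for the
  \<open>p\<^sub>s \<diamondop> q\<^sub>k\<close>.
\<close>

lemma newton_plethysm:
  assumes "s \<ge> 1"
  shows "newton (\<lambda>d. scal (1 - (tvar ^ s) ^ d) * psum (s * d)) (\<lambda>k. psum s \<diamondop> qfun k)"
proof -
  have "of_nat n * power_subst s (qfun n) =
      (\<Sum>d=1..n. scal (1 - (tvar ^ s) ^ d) * psum (s * d) * power_subst s (qfun (n - d)))" for n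
  proof -
    have "of_nat n * power_subst s (qfun n) = power_subst s (of_nat n * qfun n)"
      by (simp add: power_subst_of_nat[OF assms])
    also have "\<dots> = (\<Sum>d=1..n. scal (1 - (tvar ^ s) ^ d) * psum (s * d) * power_subst s (qfun (n - d)))"
      unfolding newton_rec[OF newton_qfun] power_subst_sum[OF assms]
      by (intro sum.cong refl) (simp add: mult.assoc power_subst_scal[OF assms]
          power_subst_psum[OF assms] subst_t_diff[OF assms] subst_t_1[OF assms]
          subst_t_tvar_power[OF assms])
    finally show ?thesis .
  qed
  then show ?thesis
    by (simp add: newton_def psum_plethysm[OF assms] newton_0[OF newton_qfun] power_subst_one[OF assms])
qed

text \<open>
  The source of the factors \<open>1 - t\<^sup>s\<close> and of the subtraction of multiples of \<open>s\<close>: the series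
  \<open>\<Sum>\<^sub>k (p\<^sub>s \<diamondop> q\<^sub>k) u\<^sup>k\<close> commutes with \<open>K(w)\<close> up to \<open>(1 - t\<^sup>s x) / (1 - x)\<close> at \<open>x = w\<^sup>s u\<close>.
\<close>

lemma K_op_plethysm_times:
  assumes "s \<ge> 1"
  shows "K_op m ((psum s \<diamondop> qfun k) * f) = (\<Sum>a\<le>k. scal (c_coeff (tvar ^ s) a) *
    (psum s \<diamondop> qfun (k - a)) * K_op (m - int s * int a) f)"
  using newton_commute[where T = K_op and \<epsilon> = 1 and \<sigma> = "- 1" and s = s and
      y = "\<lambda>k. psum s \<diamondop> qfun k" and e = "\<lambda>d. 1 - (tvar ^ s) ^ d" and c = "c_coeff (tvar ^ s)"
      and m = m and n = k and f = f]
    lin_K_op K_op_psum newton_plethysm[OF assms] newton_c_coeff[of "tvar ^ s"] assms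
  by simp

section \<open>Straightening\<close>

text \<open>
  The quadratic relation at each pair of neighbours. It holds for \<open>\<alpha> \<mapsto> H\<^sub>\<alpha>.1\<close> and for
  \<open>\<alpha> \<mapsto> K\<^bsub>\<alpha>\<^sub>l\<^esub> \<cdots> K\<^bsub>\<alpha>\<^sub>1\<^esub> f\<close>, the reversal of the order being due to adjointness.
\<close>

definition exchangeable :: "(int list \<Rightarrow> symfun) \<Rightarrow> bool" where
  "exchangeable T \<longleftrightarrow> (\<forall>xs a b ys. T (xs @ a # b # ys) =
     scal tvar * T (xs @ (a + 1) # (b - 1) # ys) - T (xs @ (b - 1) # (a + 1) # ys)
     + scal tvar * T (xs @ b # a # ys))"

text \<open>
  The weight of a step depends on the sequence only through \<open>D = \<alpha>\<^bsub>i+1\<^esub> - \<alpha>\<^sub>i\<close>.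
\<close>

definition gap_weight :: "int \<Rightarrow> nat \<Rightarrow> ratfun" where
  "gap_weight D x = (if x = 0 then tvar
    else if x < nat (D div 2) then tvar ^ (x + 1) - tvar ^ (x - 1)
    else tvar ^ (x + nat (D mod 2)) - tvar ^ (x - 1))"

text \<open>
  The relation reduces a gap \<open>D \<ge> 3\<close> to the pair \<open>(a + 1, b - 1)\<close> with gap \<open>D - 2\<close>; the weights for
  \<open>D\<close> are \<open>t\<close> times those for \<open>D - 2\<close>, shifted by one, except for the first, where the term
  \<open>- G (b - 1) (a + 1)\<close> is subtracted. For gap \<open>1\<close> this term is \<open>- G a b\<close>, which gives
  \<open>2 G a b = 2 t G b a\<close>; for gap \<open>2\<close> the terms \<open>t G\<close> and \<open>- G\<close> at \<open>(a + 1, a + 1)\<close> merge. This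
  explains the exceptional weights at the maximal shift.
\<close>

lemma straighten_pair:
  fixes G :: "int \<Rightarrow> int \<Rightarrow> symfun"
  assumes G: "\<And>a b. G a b = scal tvar * G (a + 1) (b - 1) - G (b - 1) (a + 1) + scal tvar * G b a"
    and "a < b"
  shows "G a b = (\<Sum>x\<le>nat ((b - a) div 2). scal (gap_weight (b - a) x) * G (b - int x) (a + int x))"
  using \<open>a < b\<close>
proof (induction "nat (b - a)" arbitrary: a b rule: less_induct)
  case less
  consider "b = a + 1" | "b = a + 2" | "b - a \<ge> 3" using less.prems by linarith
  then show ?case
  proof cases
    case 1
    \<comment> \<open>Here \<open>a + 1 = b\<close> and \<open>b - 1 = a\<close>, so \<open>G a b\<close> reappears on the right of the relation.\<close>
    have "2 * G a b = 2 * (scal tvar * G b a)"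
      using G[of a b] by (simp add: 1 algebra_simps)
    then have "G a b = scal tvar * G b a"
      by simp
    then show ?thesis
      by (simp add: 1 gap_weight_def)
  next
    case 2
    then show ?thesis
      using G[of a b] by (simp add: gap_weight_def scal_diff algebra_simps)
  next
    case 3
    define D where "D = b - a"
    define K where "K = nat ((D - 2) div 2)"
    have K: "nat (D div 2) = Suc K"
      using 3 by (simp add: K_def D_def)
    have w: "gap_weight D (Suc x) = tvar * gap_weight (D - 2) x - (if x = 0 then 1 else 0)" if "x \<le> K" for x
    proof -
      have "(D - 2) mod 2 = D mod 2" by (simp add: mod_diff_right_eq)
      moreover have "D mod 2 = 1" if "K = 0"
      proof -
        have "D div 2 = 1" "D \<ge> 3"
          using that K 3 by (auto simp: D_def)
        then show ?thesis by presburger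
      qed
      ultimately show ?thesis
        using that K unfolding gap_weight_def K_def[symmetric]
        by (cases x) (auto simp: algebra_simps power2_eq_square)
    qed
    have "G (a + 1) (b - 1) = (\<Sum>x\<le>K. scal (gap_weight (D - 2) x) * G (b - 1 - int x) (a + 1 + int x))"
      using less.hyps[of "b - 1" "a + 1"] 3 by (simp add: K_def D_def algebra_simps)
    then have "G a b = scal tvar * (\<Sum>x\<le>K. scal (gap_weight (D - 2) x) * G (b - 1 - int x) (a + 1 + int x))
        - G (b - 1) (a + 1) + scal tvar * G b a"
      using G[of a b] by simp
    \<comment> \<open>The correction is written as the summand \<open>x = 0\<close> of a sum over the same range.\<close>
    also have "G (b - 1) (a + 1) = (\<Sum>x\<le>K. if x = 0 then G (b - 1 - int x) (a + 1 + int x) else 0)"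
      by simp
    also have "scal tvar * (\<Sum>x\<le>K. scal (gap_weight (D - 2) x) * G (b - 1 - int x) (a + 1 + int x)) - \<dots> =
        (\<Sum>x\<le>K. scal (gap_weight D (Suc x)) * G (b - 1 - int x) (a + 1 + int x))"
      unfolding sum_distrib_left sum_subtractf[symmetric]
      by (intro sum.cong refl) (auto simp: w scal_diff scal_mult algebra_simps)
    also have "\<dots> + scal tvar * G b a =
        (\<Sum>x\<le>Suc K. scal (gap_weight D x) * G (b - int x) (a + int x))"
      by (subst sum.atMost_Suc_shift) (simp add: gap_weight_def[of D 0] algebra_simps)
    finally show ?thesis
      by (simp only: K flip: D_def)
  qed
qed

lemma split_at_pair:
  "Suc i < length \<alpha> \<Longrightarrow> \<alpha> = take i \<alpha> @ \<alpha> ! i # \<alpha> ! Suc i # drop (Suc (Suc i)) \<alpha>"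
  by (metis Cons_nth_drop_Suc Suc_lessD append_take_drop_id)

lemma S_step_eq_append:
  "Suc i < length \<alpha> \<Longrightarrow> S_step i a \<alpha> =
     take i \<alpha> @ (\<alpha> ! Suc i - int a) # (\<alpha> ! i + int a) # drop (Suc (Suc i)) \<alpha>"
  by (subst split_at_pair, assumption)
    (simp add: S_step_def nth_append list_update_append min_def)

lemma straighten_step:
  assumes "exchangeable T" "first_ascent \<alpha> i"
  shows "T \<alpha> = (\<Sum>a\<le>max_shift i \<alpha>. scal (S_weight i a \<alpha>) * T (S_step i a \<alpha>))"
proof -
  have i: "Suc i < length \<alpha>" "\<alpha> ! i < \<alpha> ! Suc i"
    using assms(2) by (auto simp: first_ascent_def)
  define G where "G a b = T (take i \<alpha> @ a # b # drop (Suc (Suc i)) \<alpha>)" for a b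
  have "G a b = scal tvar * G (a + 1) (b - 1) - G (b - 1) (a + 1) + scal tvar * G b a" for a b
    using assms(1) unfolding exchangeable_def G_def by blast
  from straighten_pair[of G, OF this i(2)]
  have "T \<alpha> = (\<Sum>x\<le>max_shift i \<alpha>. scal (gap_weight (\<alpha> ! Suc i - \<alpha> ! i) x) * T (S_step i x \<alpha>))"
    unfolding G_def S_step_eq_append[OF i(1)] max_shift_def split_at_pair[OF i(1), symmetric] .
  also have "gap_weight (\<alpha> ! Suc i - \<alpha> ! i) = (\<lambda>x. S_weight i x \<alpha>)"
    by (simp add: S_weight_def gap_weight_def max_shift_def fun_eq_iff)
  finally show ?thesis .
qed

fun weighted_sum :: "int \<Rightarrow> int list \<Rightarrow> int" where
  "weighted_sum k [] = 0"
| "weighted_sum k (x # xs) = k * x + weighted_sum (k + 1) xs"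

lemma weighted_sum_append:
  "weighted_sum k (xs @ ys) = weighted_sum k xs + weighted_sum (k + int (length xs)) ys"
  by (induction xs arbitrary: k) (simp_all add: algebra_simps)

lemma weighted_sum_ge:
  assumes "k \<ge> 0" "\<forall>x\<in>set \<alpha>. c \<le> x"
  shows "weighted_sum k (replicate (length \<alpha>) c) \<le> weighted_sum k \<alpha>"
  using assms by (induction \<alpha> arbitrary: k) (auto intro!: add_mono mult_left_mono)

lemma ascent_cases:
  fixes \<alpha> :: "int list"
  obtains "sorted_wrt (\<ge>) \<alpha>" | i where "first_ascent \<alpha> i"
proof (cases "sorted_wrt (\<ge>) \<alpha>")
  case False
  let ?P = "\<lambda>i. Suc i < length \<alpha> \<and> \<alpha> ! i < \<alpha> ! Suc i"
  have "transp (\<lambda>x y :: int. y \<le> x)" by (auto intro: transpI)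
  from sorted_wrt_iff_nth_Suc_transp[OF this] have ex: "\<exists>i. ?P i"
    using False by (auto simp: not_le)
  have "?P (LEAST i. ?P i)"
    using ex by (rule LeastI_ex)
  moreover have "\<not> ?P j" if "j < (LEAST i. ?P i)" for j
    using that by (rule not_less_Least)
  ultimately have "first_ascent \<alpha> (LEAST i. ?P i)"
    unfolding first_ascent_def by (meson Suc_lessD less_trans_Suc not_le order.strict_trans)
  then show ?thesis using that by blast
qed

text \<open>
  Straightening terminates: each step makes the right entry of a pair smaller while preserving the
  sum of the pair, so the sum of the entries weighted with their positions decreases. It is bounded
  below because a lower bound for the entries is inherited.
\<close>

lemma straighten_induct [case_names sorted ascent]:
  assumes sorted: "\<And>\<alpha>. sorted_wrt (\<ge>) \<alpha> \<Longrightarrow> P \<alpha>"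
    and ascent: "\<And>\<alpha> i. first_ascent \<alpha> i \<Longrightarrow> (\<And>a. a \<le> max_shift i \<alpha> \<Longrightarrow> P (S_step i a \<alpha>)) \<Longrightarrow> P \<alpha>"
  shows "P \<alpha>"
proof -
  obtain c where "\<forall>x\<in>set \<alpha>. c \<le> x"
    by (rule that[of "Min (insert 0 (set \<alpha>))"]) auto
  then show ?thesis
  proof (induction "nat (weighted_sum 0 \<alpha> - weighted_sum 0 (replicate (length \<alpha>) c))"
      arbitrary: \<alpha> rule: less_induct)
    case less
    show ?case
    proof (cases \<alpha> rule: ascent_cases)
      case 1
      then show ?thesis by (rule sorted)
    next
      case (2 i)
      show ?thesis
      proof (rule ascent[OF 2])
        fix a assume "a \<le> max_shift i \<alpha>"
        have i: "Suc i < length \<alpha>" "\<alpha> ! i < \<alpha> ! Suc i"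
          using 2 by (auto simp: first_ascent_def)
        then have a: "2 * int a \<le> \<alpha> ! Suc i - \<alpha> ! i"
          using \<open>a \<le> max_shift i \<alpha>\<close> by (simp add: max_shift_def)
        define xs ys x y where "xs = take i \<alpha>" "ys = drop (Suc (Suc i)) \<alpha>" "x = \<alpha> ! i" "y = \<alpha> ! Suc i"
        have eq: "\<alpha> = xs @ x # y # ys" "S_step i a \<alpha> = xs @ (y - int a) # (x + int a) # ys"
          unfolding xs_ys_x_y_def using split_at_pair[OF i(1)] S_step_eq_append[OF i(1)] by auto
        have xy: "x < y" "2 * int a \<le> y - x"
          using i a by (auto simp: xs_ys_x_y_def)
        have "\<forall>z\<in>set (xs @ x # y # ys). c \<le> z"
          using less.prems unfolding eq(1)[symmetric] .
        then have ge: "\<forall>z\<in>set (S_step i a \<alpha>). c \<le> z"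
          using xy unfolding eq(2) by auto
        have "weighted_sum 0 (S_step i a \<alpha>) < weighted_sum 0 (xs @ x # y # ys)"
          using xy unfolding eq(2) by (simp add: weighted_sum_append algebra_simps)
        then have "weighted_sum 0 (S_step i a \<alpha>) < weighted_sum 0 \<alpha>"
          unfolding eq(1)[symmetric] .
        moreover have "length (S_step i a \<alpha>) = length \<alpha>"
          by (simp add: S_step_def)
        ultimately show "P (S_step i a \<alpha>)"
          using weighted_sum_ge[of 0, OF _ ge] by (intro less.hyps[OF _ ge]) auto
      qed
    qed
  qed
qed

lemma first_ascent_unique: "first_ascent \<alpha> i \<Longrightarrow> first_ascent \<alpha> j \<Longrightarrow> i = j"
  unfolding first_ascent_def by (meson linorder_neqE_nat not_le)

lemma first_ascent_not_sorted: "first_ascent \<alpha> i \<Longrightarrow> \<not> sorted_wrt (\<ge>) \<alpha>"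
  unfolding first_ascent_def sorted_wrt_iff_nth_less by (metis lessI not_le)

lemma B_coeff_sorted:
  assumes "sorted_wrt (\<ge>) \<alpha>"
  shows "B_coeff \<rho> \<alpha> = (if \<exists>d. \<alpha> = map int \<rho> @ replicate d 0 then 1 else 0)"
proof -
  have "{ps. canonical_path \<rho> \<alpha> ps} = (if \<exists>d. \<alpha> = map int \<rho> @ replicate d 0 then {[]} else {})"
  proof -
    have "canonical_path \<rho> \<alpha> ps \<longleftrightarrow> ps = [] \<and> (\<exists>d. \<alpha> = map int \<rho> @ replicate d 0)" for ps
      using assms first_ascent_not_sorted by (cases "(\<rho>, \<alpha>, ps)" rule: canonical_path.cases) auto
    then show ?thesis by auto
  qed
  then show ?thesis by (simp add: B_coeff_def)
qed

lemma sorted_append_zeros: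
  assumes "sorted_wrt (\<ge>) (\<rho> :: nat list)"
  shows "sorted_wrt (\<ge>) (map int \<rho> @ replicate d 0)"
proof -
  have "sorted_wrt (\<ge>) (replicate d (0::int))"
    by (induction d) auto
  then show ?thesis
    using assms by (auto simp: sorted_wrt_append sorted_wrt_map)
qed

text \<open>
  Every canonical path from \<open>\<alpha>\<close> begins with a step at the first ascent, so the paths can be grouped
  according to the shift \<open>a\<close> of this step.
\<close>

lemma B_coeff_ascent:
  assumes "sorted_wrt (\<ge>) \<rho>" "first_ascent \<alpha> i"
  shows "B_coeff \<rho> \<alpha> = (\<Sum>a\<le>max_shift i \<alpha>. S_weight i a \<alpha> * B_coeff \<rho> (S_step i a \<alpha>))"
proof -
  let ?Q = "\<lambda>a. {ps. canonical_path \<rho> (S_step i a \<alpha>) ps}"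
  have paths: "{ps. canonical_path \<rho> \<alpha> ps} = (\<Union>a\<in>{..max_shift i \<alpha>}. (#) (i, a) ` ?Q a)"
  proof (intro set_eqI iffI)
    fix ps assume "ps \<in> {ps. canonical_path \<rho> \<alpha> ps}"
    then have path: "canonical_path \<rho> \<alpha> ps" by simp
    have "ps \<noteq> []"
      using path first_ascent_not_sorted[OF assms(2)] sorted_append_zeros[OF assms(1)] by auto
    then obtain j a qs where ps: "ps = (j, a) # qs"
      by (cases ps) auto
    then have "j = i"
      using path first_ascent_unique[OF _ assms(2)] by (auto simp: ps)
    then show "ps \<in> (\<Union>a\<in>{..max_shift i \<alpha>}. (#) (i, a) ` ?Q a)"
      using path by (auto simp: ps)
  qed (use assms in auto)
  have "B_coeff \<rho> \<alpha> = (\<Sum>ps\<in>(\<Union>a\<in>{..max_shift i \<alpha>}. (#) (i, a) ` ?Q a). path_weight \<alpha> ps)"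
    unfolding B_coeff_def paths ..
  also have "\<dots> = (\<Sum>a\<le>max_shift i \<alpha>. \<Sum>ps\<in>(#) (i, a) ` ?Q a. path_weight \<alpha> ps)"
    by (rule sum.UNION_disjoint) (auto simp: finite_canonical_paths)
  also have "\<dots> = (\<Sum>a\<le>max_shift i \<alpha>. S_weight i a \<alpha> * B_coeff \<rho> (S_step i a \<alpha>))"
    by (simp add: sum.reindex B_coeff_def sum_distrib_left)
  finally show ?thesis .
qed

lemma canonical_path_sum_list:
  "canonical_path \<rho> \<alpha> ps \<Longrightarrow> sum_list \<alpha> = int (sum_list \<rho>)"
proof (induction \<rho> \<alpha> ps rule: canonical_path.induct)
  case (1 \<rho> \<alpha>)
  have "sum_list (map int \<rho>) = int (sum_list \<rho>)" by (induction \<rho>) auto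
  then show ?case using 1 by (auto simp: sum_list_replicate)
next
  case (2 \<rho> \<alpha> i a ps)
  then have "Suc i < length \<alpha>" by (auto simp: first_ascent_def)
  from arg_cong[OF split_at_pair[OF this], of sum_list] S_step_eq_append[OF this, of a] 2
  show ?case by simp
qed

text \<open>
  A step at \<open>i\<close> replaces two entries by numbers that are at most \<open>\<alpha>\<^bsub>i+1\<^esub> \<le> \<lambda>\<^bsub>i+1\<^esub> \<le> \<lambda>\<^sub>i\<close>, so all
  sequences on the path stay below \<open>\<lambda>\<close>.
\<close>

lemma canonical_path_contained:
  assumes "canonical_path \<rho> \<alpha> ps" "sorted_wrt (\<ge>) lam" "length \<alpha> = length lam"
    and "\<And>j. j < length lam \<Longrightarrow> \<alpha> ! j \<le> int (lam ! j)"
  shows "part_contained \<rho> lam"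
  using assms
proof (induction \<rho> \<alpha> ps rule: canonical_path.induct)
  case (1 \<rho> \<alpha>)
  then obtain d where "\<alpha> = map int \<rho> @ replicate d 0" by auto
  then have "length \<rho> \<le> length lam"
    using 1(3) by auto
  moreover have "\<rho> ! j \<le> lam ! j" if "j < length \<rho>" for j
    using 1(4)[of j] that calculation \<open>\<alpha> = _\<close> by (simp add: nth_append)
  ultimately have *: "length \<rho> \<le> length lam" "\<And>j. j < length \<rho> \<Longrightarrow> \<rho> ! j \<le> lam ! j"
    by auto
  then show ?case by (auto simp: part_contained_def part_def)
next
  case (2 \<rho> \<alpha> i a ps)
  then have i: "Suc i < length lam" "\<alpha> ! i < \<alpha> ! Suc i" and "a \<le> max_shift i \<alpha>"
    by (auto simp: first_ascent_def)
  then have "2 * int a \<le> \<alpha> ! Suc i - \<alpha> ! i"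
    by (simp add: max_shift_def)
  moreover have "lam ! Suc i \<le> lam ! i"
    using 2(3) i by (simp add: sorted_wrt_iff_nth_less)
  ultimately have "S_step i a \<alpha> ! j \<le> int (lam ! j)" if "j < length lam" for j
    using that i 2(5)[of j] 2(5)[of "Suc i"] 2(4) by (auto simp: S_step_def nth_list_update)
  then show ?case
    using 2 by (auto simp: S_step_def)
qed

lemma B_coeff_nonzeroE:
  assumes "B_coeff \<rho> \<alpha> \<noteq> 0"
  obtains ps where "canonical_path \<rho> \<alpha> ps"
  using assms unfolding B_coeff_def by (metis (mono_tags, lifting) mem_Collect_eq sum.neutral)

section \<open>The pairing with Hall-Littlewood functions\<close>

lemma lin_fold_K_op: "lin (fold K_op \<alpha>)"
  by (induction \<alpha>) (simp_all add: lin_def lin_add[OF lin_K_op] lin_scal[OF lin_K_op])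

lemma exchangeable_fold_K_op: "exchangeable (\<lambda>\<alpha>. fold K_op \<alpha> f)"
  unfolding exchangeable_def
proof (intro allI)
  fix xs ys :: "int list" and a b :: int
  show "fold K_op (xs @ a # b # ys) f = scal tvar * fold K_op (xs @ (a + 1) # (b - 1) # ys) f
    - fold K_op (xs @ (b - 1) # (a + 1) # ys) f + scal tvar * fold K_op (xs @ b # a # ys) f"
    using arg_cong[OF K_op_exchange[of b a "fold K_op xs f"], of "fold K_op ys"]
    by (simp add: lin_add[OF lin_fold_K_op] lin_diff[OF lin_fold_K_op] lin_scal[OF lin_fold_K_op])
qed

lemma lin_foldr_H_op: "lin (foldr H_op \<alpha>)"
  by (induction \<alpha>) (simp_all add: lin_def lin_add[OF lin_H_op] lin_scal[OF lin_H_op])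

lemma exchangeable_H_seq: "exchangeable H_seq"
  unfolding exchangeable_def
proof (intro allI)
  fix xs ys :: "int list" and a b :: int
  show "H_seq (xs @ a # b # ys) = scal tvar * H_seq (xs @ (a + 1) # (b - 1) # ys)
    - H_seq (xs @ (b - 1) # (a + 1) # ys) + scal tvar * H_seq (xs @ b # a # ys)"
    using arg_cong[OF H_op_exchange[of a b "H_seq ys"], of "foldr H_op xs"]
    by (simp add: H_seq_def lin_add[OF lin_foldr_H_op] lin_diff[OF lin_foldr_H_op]
        lin_scal[OF lin_foldr_H_op])
qed

lemma H_seq_Nil: "H_seq [] = 1"
  and H_seq_Cons: "H_seq (m # \<alpha>) = H_op m (H_seq \<alpha>)"
  by (simp_all add: H_seq_def)

text \<open>
  The constant term, as an element of \<open>\<Lambda>\<close>, so that it is a linear operator in the same sense as the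
  others.
\<close>

definition const_part :: "symfun \<Rightarrow> symfun" where
  "const_part f = scal (Poly_Mapping.lookup f 0)"

lemma lin_const_part: "lin const_part"
proof -
  have "Poly_Mapping.lookup (scal c * f) 0 = c * Poly_Mapping.lookup f 0" for c and f :: symfun
    by (induction f rule: symfun_single_induct)
      (simp_all add: distrib_left lookup_add scal_times_single lookup_single when_def)
  then show ?thesis
    by (simp add: lin_def const_part_def lookup_add scal_add scal_mult)
qed

lemma const_part_one: "const_part 1 = 1"
  by (simp add: const_part_def)

lemma const_part_psum: "const_part (psum d * f) = 0"
proof (induction f rule: symfun_single_induct)
  case (add f g)
  then show ?case by (simp add: distrib_left lin_add[OF lin_const_part])
next
  case (single e c)
  have "Poly_Mapping.lookup (e + Poly_Mapping.single (d - 1) 1) (d - 1) > 0"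
    by (simp add: lookup_add)
  then have "e + Poly_Mapping.single (d - 1) 1 \<noteq> 0"
    by auto
  then show ?case
    by (simp add: psum_times_single const_part_def lookup_single_not_eq)
qed

lemma const_part_newton:
  assumes "newton (\<lambda>d. scal (e d) * psum (s * d)) y" "n > 0"
  shows "const_part (y n * f) = 0"
proof -
  have "of_nat n * const_part (y n * f) = const_part (of_nat n * y n * f)"
    using lin_scal[OF lin_const_part, of "of_nat n"] by (simp add: mult.assoc)
  also have "\<dots> = 0"
    unfolding newton_rec[OF assms(1)] sum_distrib_right lin_sum[OF lin_const_part]
    by (simp add: mult.assoc lin_scal[OF lin_const_part] const_part_psum)
  finally show ?thesis using assms(2) by simp
qed

lemma const_part_qfun: "n > 0 \<Longrightarrow> const_part (qfun n) = 0"
  using const_part_newton[where s = 1 and y = qfun and f = 1] newton_qfun by simp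

lemma const_part_rfun: "n > 0 \<Longrightarrow> const_part (rfun n) = 0"
  using const_part_newton[where s = 1 and y = rfun and f = 1] newton_rfun by simp

lemma const_part_H_op: "n > 0 \<Longrightarrow> const_part (H_op n f) = 0"
proof (induction f arbitrary: n rule: symfun_induct)
  case one
  then show ?case by (simp add: H_op_one int_seq_def const_part_qfun)
next
  case (scal c f)
  then show ?case by (simp add: lin_scal[OF lin_H_op] lin_scal[OF lin_const_part])
next
  case (add f g)
  then show ?case by (simp add: lin_add[OF lin_H_op] lin_add[OF lin_const_part])
next
  case (psum d f)
  then show ?case
    by (simp add: H_op_psum lin_diff[OF lin_const_part] const_part_psum)
qed

lemma const_part_K_op:
  "m \<le> 0 \<Longrightarrow> const_part (K_op m f) = (if m = 0 then const_part f else 0)"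
proof (induction f arbitrary: m rule: symfun_induct)
  case one
  then show ?case
    by (auto simp: K_op_one int_seq_def const_part_rfun newton_0[OF newton_rfun])
next
  case (scal c f)
  then show ?case by (simp add: lin_scal[OF lin_K_op] lin_scal[OF lin_const_part])
next
  case (add f g)
  then show ?case by (simp add: lin_add[OF lin_K_op] lin_add[OF lin_const_part])
next
  case (psum d f)
  then show ?case
    by (simp add: K_op_psum lin_add[OF lin_const_part] const_part_psum)
qed

text \<open>
  The scalar product of \<open>f\<close> with \<open>H\<^sub>\<alpha>.1 = H\<^bsub>\<alpha>\<^sub>1\<^esub> \<cdots> H\<^bsub>\<alpha>\<^sub>l\<^esub> 1\<close>: the operators are moved to
  \<open>f\<close> as their adjoints, \<open>H\<^bsub>\<alpha>\<^sub>1\<^esub>\<close> first, and the scalar product with \<open>1\<close> is the constant term.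
\<close>

definition pairing :: "int list \<Rightarrow> symfun \<Rightarrow> symfun" where
  "pairing \<alpha> f = const_part (fold K_op \<alpha> f)"

lemma lin_pairing: "lin (pairing \<alpha>)"
  unfolding pairing_def[abs_def] by (rule lin_comp[OF lin_const_part lin_fold_K_op])

lemma pairing_Nil: "pairing [] f = const_part f"
  and pairing_Cons: "pairing (m # \<alpha>) f = pairing \<alpha> (K_op m f)"
  by (simp_all add: pairing_def)

lemma pairing_append_zeros: "pairing (\<alpha> @ replicate d 0) f = pairing \<alpha> f"
proof -
  have "const_part (fold K_op (replicate d 0) g) = const_part g" for g
    by (induction d arbitrary: g) (simp_all add: const_part_K_op)
  then show ?thesis by (simp add: pairing_def)
qed

lemma pairing_append_negative: "m < 0 \<Longrightarrow> pairing (\<alpha> @ [m]) f = 0"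
  by (simp add: pairing_def const_part_K_op)

lemma pairing_straighten:
  "first_ascent \<alpha> i \<Longrightarrow>
    pairing \<alpha> f = (\<Sum>a\<le>max_shift i \<alpha>. scal (S_weight i a \<alpha>) * pairing (S_step i a \<alpha>) f)"
  unfolding pairing_def
  by (subst straighten_step[OF exchangeable_fold_K_op])
    (simp_all add: lin_sum[OF lin_const_part] lin_scal[OF lin_const_part])

text \<open>
  \<open>K\<^sub>m\<close> passes all the \<open>H\<^sub>x\<close> with \<open>x < m\<close> up to powers of \<open>t\<close>, by \<open>K_op_H_op_reorder\<close>, and
  \<open>K\<^sub>m 1 = 0\<close> for \<open>m > 0\<close>.
\<close>

lemma K_op_H_seq_vanish:
  "0 < m \<Longrightarrow> \<forall>x\<in>set \<alpha>. x < m \<Longrightarrow> K_op m (H_seq \<alpha>) = 0"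
proof (induction \<alpha> arbitrary: m)
  case Nil
  then show ?case by (simp add: H_seq_Nil K_op_one)
next
  case (Cons n \<alpha>)
  have "K_op m (H_op n (H_seq \<alpha>)) = scal tvar * H_op n (K_op m (H_seq \<alpha>))
    + (if m = n then (1 - scal tvar) * H_seq \<alpha> else 0)"
  proof (rule K_op_H_op_reorder[OF lin_id])
    fix j :: nat
    have "K_op (m + int j) (H_seq \<alpha>) = 0"
      using Cons.prems by (intro Cons.IH) auto
    then show "H_op (n + int j) (K_op (m + int j) (H_seq \<alpha>)) = 0"
      by (simp add: lin_0[OF lin_H_op])
  qed
  then show ?case
    using Cons by (simp add: H_seq_Cons lin_0[OF lin_H_op])
qed

text \<open>
  If \<open>m\<close> occurs \<open>c\<close> times, then \<open>K\<^sub>m\<close> passes the \<open>c\<close> operators \<open>H\<^sub>m\<close> one by one, leaving \<open>1 - t\<close>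
  times a power of \<open>t\<close> at each; the sum \<open>(1 - t) (1 + t + \<cdots> + t\<^bsup>c-1\<^esup>)\<close> is \<open>1 - t\<^sup>c\<close>.
\<close>

lemma K_op_H_seq_first:
  assumes "0 < m" "sorted_wrt (\<ge>) (m # \<alpha>)"
  shows "K_op m (H_seq (m # \<alpha>)) = scal (1 - tvar ^ count_list (m # \<alpha>) m) * H_seq \<alpha>"
  using assms
proof (induction \<alpha>)
  case Nil
  have "K_op m (H_op m 1) = scal tvar * H_op m (K_op m 1)
    + (if m = m then (1 - scal tvar) * 1 else 0)"
    by (rule K_op_H_op_reorder[OF lin_id])
      (use Nil in \<open>simp add: K_op_one lin_0[OF lin_H_op]\<close>)
  then show ?case
    using Nil by (simp add: H_seq_Cons H_seq_Nil K_op_one lin_0[OF lin_H_op] scal_diff)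
next
  case (Cons n \<alpha>)
  have "K_op m (H_op m (H_seq (n # \<alpha>))) = scal tvar * H_op m (K_op m (H_seq (n # \<alpha>)))
    + (if m = m then (1 - scal tvar) * H_seq (n # \<alpha>) else 0)"
  proof (rule K_op_H_op_reorder[OF lin_id])
    fix j :: nat assume "j \<ge> 1"
    then have "K_op (m + int j) (H_seq (n # \<alpha>)) = 0"
      using Cons.prems by (intro K_op_H_seq_vanish) auto
    then show "H_op (m + int j) (K_op (m + int j) (H_seq (n # \<alpha>))) = 0"
      by (simp add: lin_0[OF lin_H_op])
  qed
  moreover have "H_op m (K_op m (H_seq (n # \<alpha>))) =
      scal (1 - tvar ^ count_list (n # \<alpha>) m) * H_seq (n # \<alpha>)"
  proof (cases "n = m")
    case True
    then show ?thesis
      using Cons by (simp add: lin_scal[OF lin_H_op] H_seq_Cons)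
  next
    case False
    then have less: "\<forall>x\<in>set (n # \<alpha>). x < m"
      using Cons.prems by auto
    then have "count_list (n # \<alpha>) m = 0"
      by (auto simp: count_list_0_iff)
    then show ?thesis
      using K_op_H_seq_vanish[OF Cons.prems(1) less] by (simp add: lin_0[OF lin_H_op])
  qed
  ultimately have "K_op m (H_seq (m # n # \<alpha>)) =
      (scal tvar * scal (1 - tvar ^ count_list (n # \<alpha>) m) + (1 - scal tvar)) * H_seq (n # \<alpha>)"
    by (simp add: H_seq_Cons[of m] algebra_simps)
  also have "scal tvar * scal (1 - tvar ^ count_list (n # \<alpha>) m) + (1 - scal tvar) =
      scal (1 - tvar ^ count_list (m # n # \<alpha>) m)"
    by (simp add: scal_diff scal_mult algebra_simps)
  finally show ?case .
qed

text \<open>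
  The mirror image of \<open>K_op_H_seq_vanish\<close>: here \<open>H\<^sub>n\<close> is moved to the left through the \<open>K\<^sub>x\<close> with
  \<open>x < n\<close>, until the constant term annihilates it.
\<close>

lemma pairing_H_op_vanish:
  "0 < n \<Longrightarrow> \<forall>x\<in>set \<alpha>. x < n \<Longrightarrow> pairing \<alpha> (H_op n f) = 0"
proof (induction \<alpha> arbitrary: n f)
  case Nil
  then show ?case by (simp add: pairing_Nil const_part_H_op)
next
  case (Cons m \<alpha>)
  have "pairing \<alpha> (K_op m (H_op n f)) = scal tvar * pairing \<alpha> (H_op n (K_op m f))
    + (if m = n then (1 - scal tvar) * pairing \<alpha> f else 0)"
    by (rule K_op_H_op_reorder[OF lin_pairing], rule Cons.IH) (use Cons.prems in auto)
  then show ?case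
    using Cons by (simp add: pairing_Cons)
qed

lemma tvar_power_neq_1: "n > 0 \<Longrightarrow> tvar ^ n \<noteq> 1"
proof
  assume "n > 0" "tvar ^ n = 1"
  then have "[:0, 1:] ^ n = (1 :: rat poly)"
    by (simp add: tvar_def Fract_power One_fract_def eq_fract)
  then have "degree ([:0, 1:] ^ n :: rat poly) = 0"
    by simp
  then show False
    using \<open>n > 0\<close> by (simp add: degree_power_eq)
qed

definition is_partition :: "nat list \<Rightarrow> bool" where
  "is_partition lam \<longleftrightarrow> sorted_wrt (\<ge>) lam \<and> (\<forall>x\<in>set lam. 0 < x)"

lemma partitions_of_eq: "partitions_of n = {lam. is_partition lam \<and> sum_list lam = n}"
  by (auto simp: partitions_of_def is_partition_def)

lemma num_parts_partition: "is_partition lam \<Longrightarrow> num_parts lam = length lam"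
  by (simp add: is_partition_def num_parts_def)

text \<open>
  The factor is the one produced by \<open>K_op_H_seq_first\<close>.
\<close>

lemma b_coeff_Cons:
  assumes "is_partition (m # \<mu>)"
  shows "b_coeff (m # \<mu>) = (1 - tvar ^ count_list (m # \<mu>) m) * b_coeff \<mu>"
proof -
  have m: "0 < m" "is_partition \<mu>" "0 \<notin> set \<mu>"
    using assms by (auto simp: is_partition_def)
  have parts: "num_parts (m # \<mu>) = Suc (num_parts \<mu>)"
    using m by (simp add: num_parts_def)
  define g where "g i = qfact (count_list \<mu> i)" for i
  have "(1 - tvar) * qint (Suc (count_list \<mu> m)) = 1 - tvar ^ count_list (m # \<mu>) m"
    using tvar_power_neq_1[of 1] by (simp add: qint_def)
  moreover have "(\<Prod>i\<in>set (m # \<mu>) - {0}. qfact (count_list (m # \<mu>) i)) =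
      qint (Suc (count_list \<mu> m)) * (\<Prod>i\<in>set \<mu> - {0}. g i)"
  proof -
    have "(\<Prod>i\<in>set (m # \<mu>) - {0}. qfact (count_list (m # \<mu>) i)) =
        qfact (Suc (count_list \<mu> m)) * (\<Prod>i\<in>set \<mu> - {0} - {m}. g i)"
    proof -
      have "set (m # \<mu>) - {0} = insert m (set \<mu> - {0} - {m})"
        using m by auto
      then show ?thesis
        by (simp only:, subst prod.insert) (auto simp: g_def intro!: prod.cong)
    qed
    also have "qfact (Suc (count_list \<mu> m)) = qint (Suc (count_list \<mu> m)) * g m"
      by (simp add: qfact_def g_def mult.commute)
    also have "\<dots> * (\<Prod>i\<in>set \<mu> - {0} - {m}. g i) =
        qint (Suc (count_list \<mu> m)) * (g m * (\<Prod>i\<in>set \<mu> - {0} - {m}. g i))"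
      by (rule mult.assoc)
    also have "g m * (\<Prod>i\<in>set \<mu> - {0} - {m}. g i) = (\<Prod>i\<in>set \<mu> - {0}. g i)"
    proof (cases "m \<in> set \<mu>")
      case True
      then show ?thesis using m by (subst prod.remove[of _ m]) auto
    next
      case False
      then show ?thesis by (simp add: g_def qfact_def count_list_0_iff)
    qed
    finally show ?thesis .
  qed
  ultimately show ?thesis
    unfolding b_coeff_def parts by (simp add: g_def mult_ac)
qed

lemma b_coeff_nonzero: "b_coeff lam \<noteq> 0"
proof -
  have "qfact n \<noteq> 0" for n
    using tvar_power_neq_1 by (auto simp: qfact_def qint_def tvar_power_neq_1[of 1, simplified])
  then show ?thesis
    using tvar_power_neq_1[of 1] by (simp add: b_coeff_def)
qed

text \<open>
  Orthogonality. The first parts \<open>m\<close> of \<open>\<lambda>\<close> and \<open>n\<close> of \<open>\<mu>\<close> are compared: if \<open>n < m\<close> then \<open>K\<^sub>m\<close>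
  annihilates \<open>H\<^sub>\<mu>.1\<close>, if \<open>m < n\<close> then the pairing annihilates the image of \<open>H\<^sub>n\<close>, and if
  \<open>m = n\<close> then \<open>K\<^sub>m\<close> removes the first part of \<open>\<mu>\<close> at the cost of one factor of \<open>b\<^sub>\<mu>\<close>.
\<close>

lemma pairing_H_seq_partitions:
  assumes "is_partition lam" "is_partition \<mu>"
  shows "pairing (map int lam) (H_seq (map int \<mu>)) = (if lam = \<mu> then scal (b_coeff \<mu>) else 0)"
  using assms
proof (induction lam arbitrary: \<mu>)
  case Nil
  show ?case
  proof (cases \<mu>)
    case Nil
    then show ?thesis by (simp add: pairing_Nil H_seq_Nil const_part_one b_coeff_def num_parts_def)
  next
    case (Cons n \<mu>')
    then show ?thesis
      using \<open>is_partition \<mu>\<close> by (simp add: pairing_Nil H_seq_Cons const_part_H_op is_partition_def)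
  qed
next
  case lam: (Cons m lam)
  then have m: "0 < m" "is_partition lam"
    by (auto simp: is_partition_def)
  show ?case
  proof (cases \<mu>)
    case Nil
    then show ?thesis
      using m by (simp add: pairing_Cons H_seq_Nil K_op_one lin_0[OF lin_pairing])
  next
    case (Cons n \<mu>')
    then have \<mu>': "is_partition \<mu>'" "\<forall>x\<in>set \<mu>'. x \<le> n"
      using lam.prems by (auto simp: is_partition_def)
    consider "n < m" | "n = m" | "m < n" by linarith
    then show ?thesis
    proof cases
      case 1
      then have "K_op (int m) (H_seq (map int \<mu>)) = 0"
        using \<mu>' m by (intro K_op_H_seq_vanish) (auto simp: Cons)
      then show ?thesis
        using 1 by (simp add: Cons pairing_Cons lin_0[OF lin_pairing])
    next
      case 2
      have "count_list (map int xs) (int m) = count_list xs m" for xs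
        by (induction xs) auto
      moreover have "sorted_wrt (\<ge>) (int m # map int \<mu>')"
        using lam.prems(2) 2 by (auto simp: is_partition_def Cons sorted_wrt_map)
      ultimately have "K_op (int m) (H_seq (map int \<mu>)) =
          scal (1 - tvar ^ count_list (m # \<mu>') m) * H_seq (map int \<mu>')"
        using K_op_H_seq_first[of "int m" "map int \<mu>'"] m by (simp add: Cons 2)
      then show ?thesis
        using lam.IH[OF m(2) \<mu>'(1)] b_coeff_Cons[of m \<mu>'] lam.prems(2)
        by (simp add: Cons 2 pairing_Cons lin_scal[OF lin_pairing] scal_mult)
    next
      case 3
      have "pairing (map int (m # lam)) (H_op (int n) (H_seq (map int \<mu>'))) = 0"
        using 3 lam.prems(1) by (intro pairing_H_op_vanish) (auto simp: is_partition_def)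
      then show ?thesis
        using 3 by (simp add: Cons H_seq_Cons)
    qed
  qed
qed

text \<open>
  The endpoints of straightening. In the second case \<open>H\<^sub>m\<close> is applied to \<open>1\<close>, or \<open>K\<^sub>m\<close> is applied
  last before the constant term is taken, and either gives zero.
\<close>

lemma sorted_int_list_cases:
  assumes "sorted_wrt (\<ge>) (\<alpha> :: int list)"
  obtains lam d where "is_partition lam" "\<alpha> = map int lam @ replicate d 0"
    | \<beta> m where "\<alpha> = \<beta> @ [m]" "m < 0"
proof -
  have "(\<exists>lam d. is_partition lam \<and> \<alpha> = map int lam @ replicate d 0) \<or> (\<exists>\<beta> m. \<alpha> = \<beta> @ [m] \<and> m < 0)"
    using assms
  proof (induction \<alpha> rule: rev_induct)
    case Nil
    have "is_partition [] \<and> [] = map int [] @ replicate 0 0" by (simp add: is_partition_def)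
    then show ?case by blast
  next
    case (snoc x \<alpha>)
    have \<alpha>: "sorted_wrt (\<ge>) \<alpha>" "\<forall>y\<in>set \<alpha>. x \<le> y"
      using snoc.prems by (auto simp: sorted_wrt_append)
    show ?case
    proof (cases "x < 0")
      case False
      then have "\<not> (\<exists>\<beta> m. \<alpha> = \<beta> @ [m] \<and> m < 0)"
        using \<alpha>(2) by auto
      then obtain lam d where lam: "is_partition lam" "\<alpha> = map int lam @ replicate d 0"
        using snoc.IH[OF \<alpha>(1)] by blast
      show ?thesis
      proof (cases "x = 0")
        case True
        then have "\<alpha> @ [x] = map int lam @ replicate (Suc d) 0"
          using lam by (simp add: replicate_append_same flip: replicate_Suc)
        then show ?thesis using lam(1) by blast
      next
        case x: False
        then have "d = 0"
          using \<alpha>(2) lam(2) False by (cases d) auto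
        then have "\<alpha> @ [x] = map int (lam @ [nat x]) @ replicate 0 0"
          using lam False by simp
        moreover have "is_partition (lam @ [nat x])"
          using lam \<alpha>(2) x False by (auto simp: is_partition_def sorted_wrt_append nat_le_iff)
        ultimately show ?thesis by blast
      qed
    qed blast
  qed
  then show ?thesis using that by blast
qed

lemma map_int_append_zeros_inject:
  assumes "is_partition lam" "is_partition \<mu>" "map int lam @ replicate d 0 = map int \<mu> @ replicate e 0"
  shows "lam = \<mu>"
proof -
  have "filter (\<lambda>x. x > 0) (map int xs @ replicate c 0) = map int xs" if "is_partition xs" for xs c
    using that by (auto simp: is_partition_def filter_id_conv)
  from arg_cong[OF assms(3), of "filter (\<lambda>x. x > 0)"] this[OF assms(1)] this[OF assms(2)]
  have "map int lam = map int \<mu>" by simp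
  then show ?thesis by (simp add: inj_map_eq_map)
qed

text \<open>
  Both sides satisfy the same recursion along the first ascent. At the endpoints orthogonality
  picks out the paths that end at \<open>\<mu>\<close>.
\<close>

lemma pairing_H_seq:
  assumes "is_partition \<mu>"
  shows "pairing \<alpha> (H_seq (map int \<mu>)) = scal (B_coeff \<mu> \<alpha> * b_coeff \<mu>)"
proof (induction \<alpha> rule: straighten_induct)
  case (sorted \<alpha>)
  then show ?case
  proof (cases rule: sorted_int_list_cases)
    case (1 lam d)
    have "(\<exists>e. \<alpha> = map int \<mu> @ replicate e 0) \<longleftrightarrow> lam = \<mu>"
      using map_int_append_zeros_inject[OF 1(1) assms, of d] 1(2) by auto
    then show ?thesis
      using pairing_H_seq_partitions[OF 1(1) assms] B_coeff_sorted[OF sorted, of \<mu>]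
      by (simp add: 1(2) pairing_append_zeros)
  next
    case (2 \<beta> m)
    have "\<nexists>e. \<alpha> = map int \<mu> @ replicate e 0"
    proof
      assume "\<exists>e. \<alpha> = map int \<mu> @ replicate e 0"
      then have "\<forall>x\<in>set \<alpha>. x \<ge> 0" by auto
      then show False using 2 by auto
    qed
    then show ?thesis
      using B_coeff_sorted[OF sorted, of \<mu>] 2 by (simp add: pairing_append_negative)
  qed
next
  case (ascent \<alpha> i)
  have "sorted_wrt (\<ge>) \<mu>" using assms by (simp add: is_partition_def)
  from B_coeff_ascent[OF this ascent.hyps] show ?case
    using ascent by (simp add: pairing_straighten scal_sum sum_distrib_right scal_mult mult.assoc)
qed

lemma compositions_of_Suc:
  "compositions_of k (Suc l) = (\<Union>a\<in>{..k}. (#) a ` compositions_of (k - a) l)"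
proof (intro set_eqI iffI)
  fix \<nu> assume "\<nu> \<in> compositions_of k (Suc l)"
  then obtain a \<nu>' where "\<nu> = a # \<nu>'" "length \<nu>' = l" "a + sum_list \<nu>' = k"
    by (cases \<nu>) (auto simp: compositions_of_def)
  then show "\<nu> \<in> (\<Union>a\<in>{..k}. (#) a ` compositions_of (k - a) l)"
    by (intro UN_I[of a]) (auto simp: compositions_of_def)
qed (auto simp: compositions_of_def)

text \<open>
  The entry \<open>\<nu>\<^sub>i\<close> is the part of the degree \<open>k\<close> that is consumed when \<open>K\<^bsub>\<alpha>\<^sub>i\<^esub>\<close> passes the plethysm.
  What remains in the end is the constant term of \<open>p\<^sub>s \<diamondop> q\<^sub>j\<close>, which vanishes unless \<open>j = 0\<close>;
  hence the \<open>\<nu>\<^sub>i\<close> add up to \<open>k\<close>.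
\<close>

lemma pairing_plethysm_times:
  assumes "s \<ge> 1"
  shows "pairing \<alpha> ((psum s \<diamondop> qfun k) * f) =
    (\<Sum>\<nu>\<in>compositions_of k (length \<alpha>). scal ((1 - tvar ^ s) ^ num_parts \<nu>) *
      pairing (map2 (\<lambda>x y. x - int s * int y) \<alpha> \<nu>) f)"
proof (induction \<alpha> arbitrary: k f)
  case Nil
  have "compositions_of k 0 = (if k = 0 then {[]} else {})"
    by (auto simp: compositions_of_def)
  then show ?case
    using newton_0[OF newton_plethysm[OF assms]] const_part_newton[OF newton_plethysm[OF assms], of k f]
    by (simp add: pairing_Nil num_parts_def)
next
  case (Cons m \<alpha>)
  have c: "scal (c_coeff (tvar ^ s) a) * scal ((1 - tvar ^ s) ^ num_parts \<nu>) =
      scal ((1 - tvar ^ s) ^ num_parts (a # \<nu>))" for a \<nu>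
    by (simp add: c_coeff_def num_parts_def scal_mult)
  have "pairing (m # \<alpha>) ((psum s \<diamondop> qfun k) * f) =
      (\<Sum>a\<le>k. scal (c_coeff (tvar ^ s) a) *
        pairing \<alpha> ((psum s \<diamondop> qfun (k - a)) * K_op (m - int s * int a) f))"
    by (simp add: pairing_Cons K_op_plethysm_times[OF assms] lin_sum[OF lin_pairing]
        mult.assoc lin_scal[OF lin_pairing])
  also have "\<dots> = (\<Sum>a\<le>k. \<Sum>\<nu>\<in>compositions_of (k - a) (length \<alpha>).
      scal ((1 - tvar ^ s) ^ num_parts (a # \<nu>)) *
      pairing (map2 (\<lambda>x y. x - int s * int y) (m # \<alpha>) (a # \<nu>)) f)"
    unfolding Cons.IH sum_distrib_left mult.assoc[symmetric] c by (simp add: pairing_Cons)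
  also have "\<dots> = (\<Sum>a\<le>k. \<Sum>\<nu>\<in>(#) a ` compositions_of (k - a) (length \<alpha>).
      scal ((1 - tvar ^ s) ^ num_parts \<nu>) * pairing (map2 (\<lambda>x y. x - int s * int y) (m # \<alpha>) \<nu>) f)"
    by (simp add: sum.reindex)
  also have "\<dots> = (\<Sum>\<nu>\<in>compositions_of k (length (m # \<alpha>)).
      scal ((1 - tvar ^ s) ^ num_parts \<nu>) * pairing (map2 (\<lambda>x y. x - int s * int y) (m # \<alpha>) \<nu>) f)"
    unfolding length_Cons compositions_of_Suc
    by (rule sum.UNION_disjoint[symmetric]) (auto simp: finite_compositions_of)
  finally show ?case .
qed

section \<open>The Hall-Littlewood functions span \<open>\<Lambda>\<close>\<close>

definition HL_span :: "symfun set" where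
  "HL_span = {f. \<exists>F c. finite F \<and> (\<forall>lam\<in>F. is_partition lam) \<and>
     f = (\<Sum>lam\<in>F. scal (c lam) * H_seq (map int lam))}"

lemma HL_spanI:
  assumes "finite F" "\<forall>lam\<in>F. is_partition lam"
    and "f = (\<Sum>lam\<in>F. scal (c lam) * H_seq (map int lam))"
  shows "f \<in> HL_span"
  unfolding HL_span_def by (intro CollectI exI[of _ F] exI[of _ c] conjI assms)

lemma HL_span_H_seq_partition: "is_partition lam \<Longrightarrow> H_seq (map int lam) \<in> HL_span"
  by (rule HL_spanI[of "{lam}" _ "\<lambda>_. 1"]) simp_all

lemma HL_span_0: "0 \<in> HL_span"
  by (rule HL_spanI[of "{}"]) simp_all

lemma HL_span_scal:
  assumes "f \<in> HL_span" shows "scal a * f \<in> HL_span"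
proof -
  obtain F c where F: "finite F" "\<forall>lam\<in>F. is_partition lam"
    "f = (\<Sum>lam\<in>F. scal (c lam) * H_seq (map int lam))"
    using assms by (auto simp: HL_span_def)
  have "scal a * f = (\<Sum>lam\<in>F. scal (a * c lam) * H_seq (map int lam))"
    by (simp add: F(3) sum_distrib_left scal_mult mult.assoc)
  then show ?thesis
    by (rule HL_spanI[OF F(1,2)])
qed

lemma HL_span_add:
  assumes "f \<in> HL_span" "g \<in> HL_span" shows "f + g \<in> HL_span"
proof -
  obtain F c where F: "finite F" "\<forall>lam\<in>F. is_partition lam"
    "f = (\<Sum>lam\<in>F. scal (c lam) * H_seq (map int lam))"
    using assms by (auto simp: HL_span_def)
  obtain G d where G: "finite G" "\<forall>lam\<in>G. is_partition lam"
    "g = (\<Sum>lam\<in>G. scal (d lam) * H_seq (map int lam))"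
    using assms by (auto simp: HL_span_def)
  define c' d' where "c' lam = (if lam \<in> F then c lam else 0)"
    and "d' lam = (if lam \<in> G then d lam else 0)" for lam
  have "f = (\<Sum>lam\<in>F \<union> G. scal (c' lam) * H_seq (map int lam))"
    unfolding F(3) using F(1) G(1) by (intro sum.mono_neutral_cong_left) (auto simp: c'_def)
  moreover have "g = (\<Sum>lam\<in>F \<union> G. scal (d' lam) * H_seq (map int lam))"
    unfolding G(3) using F(1) G(1) by (intro sum.mono_neutral_cong_left) (auto simp: d'_def)
  ultimately have "f + g = (\<Sum>lam\<in>F \<union> G. scal (c' lam + d' lam) * H_seq (map int lam))"
    by (simp add: sum.distrib scal_add distrib_right)
  moreover have "finite (F \<union> G)" "\<forall>lam\<in>F \<union> G. is_partition lam"
    using F G by auto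
  ultimately show ?thesis
    by (intro HL_spanI)
qed

lemma HL_span_sum: "(\<And>x. x \<in> A \<Longrightarrow> f x \<in> HL_span) \<Longrightarrow> (\<Sum>x\<in>A. f x) \<in> HL_span"
  by (induction A rule: infinite_finite_induct) (auto intro: HL_span_0 HL_span_add)

lemma HL_span_diff: "f \<in> HL_span \<Longrightarrow> g \<in> HL_span \<Longrightarrow> f - g \<in> HL_span"
  using HL_span_add[of f "scal (- 1) * g"] HL_span_scal[of g "- 1"] by (simp add: scal_uminus)

lemma HL_span_H_seq: "H_seq \<alpha> \<in> HL_span"
proof (induction \<alpha> rule: straighten_induct)
  case (sorted \<alpha>)
  then show ?case
  proof (cases rule: sorted_int_list_cases)
    case (1 lam d)
    have "H_op 0 1 = 1"
      unfolding H_op_one int_seq_def by (simp add: newton_0[OF newton_qfun])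
    then have "foldr H_op (replicate d 0) 1 = 1"
      by (induction d) simp_all
    then have "H_seq \<alpha> = H_seq (map int lam)"
      unfolding 1(2) H_seq_def by simp
    then show ?thesis
      using HL_span_H_seq_partition[OF 1(1)] by simp
  next
    case (2 \<beta> m)
    have "H_op m 1 = 0"
      unfolding H_op_one using 2(2) by simp
    then have "H_seq \<alpha> = 0"
      unfolding 2(1) H_seq_def by (simp add: lin_0[OF lin_foldr_H_op])
    then show ?thesis by (simp add: HL_span_0)
  qed
next
  case (ascent \<alpha> i)
  show ?case
    unfolding straighten_step[OF exchangeable_H_seq ascent.hyps]
    by (intro HL_span_sum HL_span_scal ascent.IH) simp
qed

text \<open>
  By \<open>H_op_q_times\<close>, \<open>q\<^sub>n H\<^sub>m\<close> equals \<open>H\<^sub>m q\<^sub>n\<close> up to terms \<open>q\<^bsub>n-a\<^esub> H\<^bsub>m+a\<^esub>\<close> with \<open>a \<ge> 1\<close>. So \<open>q\<^sub>n\<close>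
  can be moved to the right, where \<open>q\<^sub>n 1 = H\<^sub>n 1\<close>, by induction on the operators still to be passed
  and on \<open>n\<close>. The prefix \<open>\<beta>\<close> collects the operators already passed.
\<close>

lemma HL_span_q_times_H_seq: "foldr H_op \<beta> (qfun n * H_seq \<alpha>) \<in> HL_span"
proof (induction \<alpha> arbitrary: \<beta> n)
  case Nil
  have "foldr H_op \<beta> (qfun n * H_seq []) = H_seq (\<beta> @ [int n])"
    by (simp add: H_seq_def H_op_one)
  then show ?case by (simp add: HL_span_H_seq)
next
  case (Cons m \<alpha>)
  note outer = Cons.IH
  show ?case
  proof (induction n arbitrary: m rule: less_induct)
    case (less n)
    let ?t = "\<lambda>a. scal (a_coeff tvar a) * (qfun (n - a) * H_seq ((m + int a) # \<alpha>))"
    have "H_op m (qfun n * H_seq \<alpha>) = (\<Sum>a\<le>n. ?t a)"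
      unfolding H_op_q_times by (simp add: H_seq_Cons mult.assoc)
    also have "{..n} = insert 0 {1..n}" by auto
    finally have "qfun n * H_seq (m # \<alpha>) = H_op m (qfun n * H_seq \<alpha>) - (\<Sum>a=1..n. ?t a)"
      by (simp add: a_coeff_def)
    then have "foldr H_op \<beta> (qfun n * H_seq (m # \<alpha>)) = foldr H_op (\<beta> @ [m]) (qfun n * H_seq \<alpha>) -
        (\<Sum>a=1..n. scal (a_coeff tvar a) * foldr H_op \<beta> (qfun (n - a) * H_seq ((m + int a) # \<alpha>)))"
      by (simp add: lin_diff[OF lin_foldr_H_op] lin_sum[OF lin_foldr_H_op] lin_scal[OF lin_foldr_H_op])
    moreover have "foldr H_op \<beta> (qfun (n - a) * H_seq ((m + int a) # \<alpha>)) \<in> HL_span" if "a \<in> {1..n}" for a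
      using that by (intro less) auto
    ultimately show ?case
      using outer[of "\<beta> @ [m]" n] by (auto intro!: HL_span_diff HL_span_sum HL_span_scal)
  qed
qed

lemma HL_span_q_times:
  assumes "f \<in> HL_span" shows "qfun n * f \<in> HL_span"
proof -
  obtain F c where F: "finite F" "\<forall>lam\<in>F. is_partition lam"
    "f = (\<Sum>lam\<in>F. scal (c lam) * H_seq (map int lam))"
    using assms by (auto simp: HL_span_def)
  have "qfun n * f = (\<Sum>lam\<in>F. scal (c lam) * (qfun n * H_seq (map int lam)))"
    by (simp add: F(3) sum_distrib_left mult.left_commute)
  also have "\<dots> \<in> HL_span"
    using HL_span_q_times_H_seq[of "[]"] by (intro HL_span_sum HL_span_scal) simp
  finally show ?thesis .
qed

text \<open>
  The recursion for \<open>q\<^sub>n\<close> contains \<open>p\<^sub>n\<close> with the nonzero coefficient \<open>1 - t\<^sup>n\<close>, so products with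
  \<open>p\<^sub>n\<close> reduce to products with \<open>q\<^sub>j\<close>, \<open>j \<le> n\<close>, and with \<open>p\<^sub>d\<close>, \<open>d < n\<close>.
\<close>

lemma HL_span_psum_times: "n \<ge> 1 \<Longrightarrow> f \<in> HL_span \<Longrightarrow> psum n * f \<in> HL_span"
proof (induction n arbitrary: f rule: less_induct)
  case (less n)
  let ?t = "\<lambda>d. scal (1 - tvar ^ d) * (psum d * (qfun (n - d) * f))"
  have "of_nat n * qfun n * f = (\<Sum>d=1..n. ?t d)"
    unfolding newton_rec[OF newton_qfun] by (simp add: sum_distrib_right mult.assoc)
  also have "{1..n} = insert n {1..<n}"
    using less.prems by auto
  finally have "scal (1 - tvar ^ n) * (psum n * f) = scal (of_nat n) * (qfun n * f) - (\<Sum>d\<in>{1..<n}. ?t d)"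
    by (simp add: newton_0[OF newton_qfun] mult.assoc)
  also have "\<dots> \<in> HL_span"
    using less by (intro HL_span_diff HL_span_sum HL_span_scal less.IH HL_span_q_times) auto
  finally have "scal (1 / (1 - tvar ^ n)) * (scal (1 - tvar ^ n) * (psum n * f)) \<in> HL_span"
    by (rule HL_span_scal)
  moreover have "scal (1 / (1 - tvar ^ n)) * scal (1 - tvar ^ n) = 1"
    using tvar_power_neq_1[of n] less.prems by (simp flip: scal_mult)
  ultimately show ?case
    by (simp flip: mult.assoc)
qed

lemma HL_span_UNIV: "f \<in> HL_span"
proof (induction f rule: symfun_induct)
  case one
  show ?case using HL_span_H_seq[of "[]"] by (simp add: H_seq_Nil)
qed (auto intro: HL_span_scal HL_span_add HL_span_psum_times)

lemma scal_eq_0_iff: "scal a = 0 \<longleftrightarrow> a = 0"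
  unfolding scal_def by (metis lookup_single_eq lookup_zero single_zero)

text \<open>
  By orthogonality the pairings with \<open>f - g\<close> are, up to the nonzero norms, its coefficients in the
  spanning set of Hall-Littlewood functions.
\<close>

lemma pairing_nondegenerate:
  assumes "\<And>lam. is_partition lam \<Longrightarrow> pairing (map int lam) f = pairing (map int lam) g"
  shows "f = g"
proof -
  obtain F c where F: "finite F" "\<forall>lam\<in>F. is_partition lam"
    "f - g = (\<Sum>lam\<in>F. scal (c lam) * H_seq (map int lam))"
    using HL_span_UNIV[of "f - g"] by (auto simp: HL_span_def)
  have "c lam = 0" if "lam \<in> F" for lam
  proof -
    have "0 = pairing (map int lam) (f - g)"
      using assms F(2) that by (simp add: lin_diff[OF lin_pairing])
    also have "\<dots> = (\<Sum>\<mu>\<in>F. scal (c \<mu>) * pairing (map int lam) (H_seq (map int \<mu>)))"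
      by (simp add: F(3) lin_sum[OF lin_pairing] lin_scal[OF lin_pairing])
    also have "\<dots> = (\<Sum>\<mu>\<in>F. if lam = \<mu> then scal (c \<mu> * b_coeff \<mu>) else 0)"
      using F(2) that by (intro sum.cong) (auto simp: pairing_H_seq_partitions scal_mult)
    also have "\<dots> = scal (c lam * b_coeff lam)"
      using F(1) that by simp
    finally show ?thesis
      using b_coeff_nonzero[of lam] scal_eq_0_iff[of "c lam * b_coeff lam"] by simp
  qed
  then show ?thesis using F(3) by simp
qed

section \<open>The expansion of the product\<close>

lemma sum_list_sub_scaled:
  "length lam = length \<nu> \<Longrightarrow>
    sum_list (sub_scaled lam s \<nu>) = int (sum_list lam) - int s * int (sum_list \<nu>)"
  by (induction lam \<nu> rule: list_induct2) (simp_all add: sub_scaled_def algebra_simps)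

text \<open>
  Straightening preserves the sum of the entries and stays below \<open>\<lambda>\<close>. So only the partitions
  \<open>\<lambda> \<turnstile> n + sk\<close> with \<open>\<mu> \<subset> \<lambda>\<close> have a nonzero pairing with the product.
\<close>

lemma B_coeff_sub_scaled_nonzero:
  assumes "is_partition lam" "\<nu> \<in> compositions_of k (length lam)"
    and "B_coeff \<mu> (sub_scaled lam s \<nu>) \<noteq> 0"
  shows "sum_list lam = sum_list \<mu> + s * k" "part_contained \<mu> lam"
proof -
  obtain ps where path: "canonical_path \<mu> (sub_scaled lam s \<nu>) ps"
    using assms(3) by (rule B_coeff_nonzeroE)
  have \<nu>: "length lam = length \<nu>" "sum_list \<nu> = k"
    using assms(2) by (auto simp: compositions_of_def)
  have "int (sum_list lam) - int s * int k = int (sum_list \<mu>)"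
    using canonical_path_sum_list[OF path] sum_list_sub_scaled[OF \<nu>(1)] \<nu>(2) by simp
  then have "int (sum_list lam) = int (sum_list \<mu> + s * k)"
    by simp
  then show "sum_list lam = sum_list \<mu> + s * k"
    by (simp only: of_nat_eq_iff)
  show "part_contained \<mu> lam"
    using assms(1) \<nu>(1)
    by (intro canonical_path_contained[OF path]) (auto simp: is_partition_def sub_scaled_def)
qed

theorem theorem4p6:
  fixes s k n :: nat and \<mu> :: "nat list"
  assumes "s \<ge> 1" and "k \<ge> 1" and "\<mu> \<in> partitions_of n"
  shows "(psum s \<diamondop> qfun k) * H_seq (map int \<mu>) =
    (\<Sum>lam\<in>{lam \<in> partitions_of (n + s * k). part_contained \<mu> lam}.
       \<Sum>\<nu>\<in>compositions_of k (num_parts lam).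
         scal (b_coeff \<mu> / b_coeff lam * (1 - tvar ^ s) ^ num_parts \<nu>
               * B_coeff \<mu> (sub_scaled lam s \<nu>))
           * H_seq (map int lam))"
  (is "?L = (\<Sum>lam\<in>?P. \<Sum>\<nu>\<in>_. scal (?c lam \<nu>) * _)")
proof (rule pairing_nondegenerate)
  have \<mu>: "is_partition \<mu>" "sum_list \<mu> = n"
    using assms(3) by (auto simp: partitions_of_eq)
  have P: "is_partition lam" if "lam \<in> ?P" for lam
    using that by (simp add: partitions_of_eq)
  fix rho assume rho: "is_partition rho"
  have "map2 (\<lambda>x y. x - int s * int y) (map int rho) \<nu> = sub_scaled rho s \<nu>" for \<nu>
    by (simp add: sub_scaled_def zip_map1 case_prod_unfold)
  then have "pairing (map int rho) ?L = (\<Sum>\<nu>\<in>compositions_of k (length rho).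
      scal ((1 - tvar ^ s) ^ num_parts \<nu> * (B_coeff \<mu> (sub_scaled rho s \<nu>) * b_coeff \<mu>)))"
    by (simp add: pairing_plethysm_times[OF assms(1)] pairing_H_seq[OF \<mu>(1)] scal_mult)
  also have "\<dots> = (if rho \<in> ?P then
      \<Sum>\<nu>\<in>compositions_of k (num_parts rho). scal (?c rho \<nu> * b_coeff rho) else 0)"
  proof (cases "rho \<in> ?P")
    case True
    then show ?thesis
      using b_coeff_nonzero[of rho] by (simp add: num_parts_partition[OF rho] mult_ac)
  next
    case False
    have "B_coeff \<mu> (sub_scaled rho s \<nu>) = 0" if "\<nu> \<in> compositions_of k (length rho)" for \<nu>
      using B_coeff_sub_scaled_nonzero[OF rho that, of \<mu> s] False rho \<mu>(2)
      by (auto simp: partitions_of_eq)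
    then show ?thesis
      unfolding if_not_P[OF False] by simp
  qed
  also have "\<dots> = (\<Sum>lam\<in>?P. if rho = lam then
      \<Sum>\<nu>\<in>compositions_of k (num_parts lam). scal (?c lam \<nu> * b_coeff lam) else 0)"
    by (rule sum.delta'[symmetric]) (simp add: finite_partitions_of)
  also have "\<dots> = pairing (map int rho)
      (\<Sum>lam\<in>?P. \<Sum>\<nu>\<in>compositions_of k (num_parts lam). scal (?c lam \<nu>) * H_seq (map int lam))"
    unfolding lin_sum[OF lin_pairing] lin_scal[OF lin_pairing]
    by (intro sum.cong refl) (auto simp: pairing_H_seq_partitions[OF rho P] simp flip: scal_mult)
  finally show "pairing (map int rho) ?L = pairing (map int rho)
      (\<Sum>lam\<in>?P. \<Sum>\<nu>\<in>compositions_of k (num_parts lam). scal (?c lam \<nu>) * H_seq (map int lam))" .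
qed

end
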